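(* Assume that the noise $(\xi_t)_{t\ge 0}$ satisfies the following two conditions. (i) For each $n\ge 1$ and $k\ge 1$ the vector $\zeta(n)=(\zeta_1(n),\ldots,\zeta_k(n))'$ with components $\zeta_j(n)=\frac{1}{\sqrt n}\int_0^n\phi_j(t)\,d\xi_t$ is Gaussian with non-degenerate covariance matrix $B_{k,n}=\mathbf{E}\,\zeta(n)\zeta'(n)$. (ii) $\sup_{k\ge1}\sup_{n\ge1}\lambda_{\max}(B_{k,n})\le\lambda^*$, where $\lambda_{\max}$ is the maximal eigenvalue and $\lambda^*$ is a known positive constant. Then for any class of projective estimators $(\widetilde S_m)_{m\in\mathcal M}$ the general model selection procedure $\widetilde S_{\widetilde m}$ satisfies $$\mathbf{E}_S\|\widetilde S_{\widetilde m}-S\|^2\le\inf_{m\in\mathcal M}\widetilde a_m(S)+\frac{\lambda^*\tau_0}{n},$$ where $$\widetilde a_m(S)=3\,\mathbf{E}_S\|\widetilde S_m-S\|^2+16\lambda^*z_*\frac{d_m l_m}{n},\qquad \tau_0=\frac{16\,l^*z_*}{z_*-1}.$$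
   Context: Model: $dy_t=S(t)\,dt+d\xi_t$, where $S$ is an unknown $1$-periodic function, square integrable on $[0,1]$. The noise $(\xi_t)_{t\ge0}$ is a continuous Gaussian process with zero mean such that for each $n\ge1$ the stochastic integral $\int_0^n f(t)\,d\xi_t$ is well defined (and linear in $f$) for every non-random $f\in L_2[0,n]$. The correlation function of $\xi$ is unknown. The process $(y_t)_{0\le t\le n}$ is observed, with $n\ge1$ fixed, and $\int_0^n x(t)\,dy_t=\int_0^n x(t)S(t)\,dt+\int_0^n x(t)\,d\xi_t$. $\mathbf{E}_S$ denotes expectation with respect to the distribution of the observed process given $S$. $\mathcal X$ is the Hilbert space of square integrable $1$-periodic functions on $\mathbb R$ with $(x,y)=\int_0^1x(t)y(t)\,dt$ and $\|x\|^2=(x,x)$. $(\phi_j)_{j\ge1}$ is an orthonormal system in $\mathcal X$. $\mathcal M$ is a finite set of finite subsets of $\mathbb N=\{1,2,\ldots\}$. For $m\in\mathcal M$, $\mathcal D_m=\{\sum_{j\in m}\lambda_j\phi_j:\lambda_j\in\mathbb R\}$ and $d_m=\dim\mathcal D_m$ is the number of elements of $m$. A class of projective estimators is a family $(\widetilde S_m)_{m\in\mathcal M}$, where each $\widetilde S_m$ is an arbitrary measurable function of $(y_t)_{0\le t\le n}$ with values in $\mathcal D_m$. The weights $(l_m)_{m\in\mathcal M}$ satisfy $l_m\ge1$, and $l^*=\sum_{m\in\mathcal M}e^{-l_md_m}$. The number $z_*$ is the maximal root of $\ln z=z-2$ ($z_*\approx3.1462$). The penalty is $P_n(m)=\rho\,\frac{l_md_m}{n}$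 with $\rho=4\lambda^*\frac{z_*^2}{z_*-1}$. The contrast is $\gamma_n(x)=\|x\|^2-\frac2n\int_0^nx(t)\,dy_t$; for $x=\sum_j c_j\phi_j$ with random $c_j$ (finite sum), the integral is understood as $\sum_jc_j\int_0^n\phi_j(t)\,dy_t$. The model selection procedure is $\widetilde S_{\widetilde m}$ with $\widetilde m=\operatorname{argmin}_{m\in\mathcal M}\{\gamma_n(\widetilde S_m)+P_n(m)\}$. *)

theory Defs
  imports "HOL-Probability.Probability" "Jordan_Normal_Form.Spectral_Radius"
begin

section \<open>Square integrable functions\<close>

definition L2_on :: "real \<Rightarrow> (real \<Rightarrow> real) set" where
  "L2_on T = {f. set_borel_measurable lebesgue {0..T} f \<and>
                 set_integrable lebesgue {0..T} (\<lambda>t. (f t)\<^sup>2)}"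

definition L2_per :: "(real \<Rightarrow> real) set" where
  "L2_per = {f \<in> L2_on 1. \<forall>t. f (t + 1) = f t}"

definition ip :: "(real \<Rightarrow> real) \<Rightarrow> (real \<Rightarrow> real) \<Rightarrow> real" where
  "ip x y = (LINT t:{0..1}|lebesgue. x t * y t)"

definition normsq :: "(real \<Rightarrow> real) \<Rightarrow> real" where
  "normsq x = ip x x"

text \<open>Here and below, sequences \<open>\<phi>\<close> are indexed by \<open>j \<ge> 1\<close>; the value \<open>\<phi> 0\<close> plays no role.\<close>

definition orthonormal_system :: "(nat \<Rightarrow> real \<Rightarrow> real) \<Rightarrow> bool" where
  "orthonormal_system \<phi> \<longleftrightarrow>
     (\<forall>j\<ge>1. \<phi> j \<in> L2_per) \<and>
     (\<forall>i\<ge>1. \<forall>j\<ge>1. ip (\<phi> i) (\<phi> j) = (if i = j then 1 else 0))"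

definition D_space :: "(nat \<Rightarrow> real \<Rightarrow> real) \<Rightarrow> nat set \<Rightarrow> (real \<Rightarrow> real) set" where
  "D_space \<phi> m = range (\<lambda>c t. \<Sum>j\<in>m. c j * \<phi> j t)"


section \<open>Gaussian families\<close>

definition normal_rv :: "'w measure \<Rightarrow> ('w \<Rightarrow> real) \<Rightarrow> bool" where
  "normal_rv M X \<longleftrightarrow> X \<in> borel_measurable M \<and>
     ((\<exists>\<mu> \<sigma>. 0 < \<sigma> \<and> distributed M lborel X (\<lambda>x. ennreal (normal_density \<mu> \<sigma> x))) \<or>
      (\<exists>\<mu>. AE \<omega> in M. X \<omega> = \<mu>))"

text \<open>A family is Gaussian iff all its finite linear combinations are normal, the degenerate
  case of an almost surely constant variable being included.\<close>

definition gaussian_family :: "'w measure \<Rightarrow> 'i set \<Rightarrow> ('i \<Rightarrow> 'w \<Rightarrow> real) \<Rightarrow> bool" where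
  "gaussian_family M J X \<longleftrightarrow>
     (\<forall>F c. finite F \<and> F \<subseteq> J \<longrightarrow> normal_rv M (\<lambda>\<omega>. \<Sum>i\<in>F. c i * X i \<omega>))"


section \<open>Stochastic integrals of non-random functions\<close>

text \<open>A list of triples \<open>(a, u, v)\<close> encodes the step function that is the sum of the
  \<open>a \<cdot> 1\<^bsub>(u,v]\<^esub>\<close>; the triples need not describe disjoint intervals.\<close>

definition steps_on :: "real \<Rightarrow> (real \<times> real \<times> real) list set" where
  "steps_on T = {s. \<forall>(a, u, v) \<in> set s. 0 \<le> u \<and> u \<le> v \<and> v \<le> T}"

definition step_fun :: "(real \<times> real \<times> real) list \<Rightarrow> real \<Rightarrow> real" where
  "step_fun s t = (\<Sum>(a, u, v)\<leftarrow>s. a * indicator {u<..v} t)"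

definition step_integral ::
    "(real \<Rightarrow> 'w \<Rightarrow> real) \<Rightarrow> (real \<times> real \<times> real) list \<Rightarrow> 'w \<Rightarrow> real" where
  "step_integral \<xi> s \<omega> = (\<Sum>(a, u, v)\<leftarrow>s. a * (\<xi> v \<omega> - \<xi> u \<omega>))"

text \<open>\<open>X\<close> is a stochastic integral of \<open>f\<close> over \<open>[0,T]\<close> if it is a mean square limit of
  integrals of step functions that converge to \<open>f\<close> in \<open>L\<^sub>2[0,T]\<close>.\<close>

definition has_stoch_integral ::
    "'w measure \<Rightarrow> (real \<Rightarrow> 'w \<Rightarrow> real) \<Rightarrow> real \<Rightarrow> (real \<Rightarrow> real) \<Rightarrow> ('w \<Rightarrow> real) \<Rightarrow> bool" where
  "has_stoch_integral M \<xi> T f X \<longleftrightarrow> X \<in> borel_measurable M \<and>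
     (\<exists>s. (\<forall>k. s k \<in> steps_on T) \<and>
          (\<lambda>k::nat. \<integral>\<^sup>+t\<in>{0..T}. ennreal ((step_fun (s k) t - f t)\<^sup>2) \<partial>lebesgue)
             \<longlonglongrightarrow> 0 \<and>
          (\<lambda>k. \<integral>\<^sup>+\<omega>. ennreal ((step_integral \<xi> (s k) \<omega> - X \<omega>)\<^sup>2) \<partial>M) \<longlonglongrightarrow> 0)"

text \<open>Well-definedness: the integral exists and does not depend, up to null sets, on the
  approximating sequence. Linearity in \<open>f\<close> (almost surely) follows, since sums and multiples of
  approximating sequences approximate sums and multiples.\<close>

definition stoch_integral_well_defined ::
    "'w measure \<Rightarrow> (real \<Rightarrow> 'w \<Rightarrow> real) \<Rightarrow> real \<Rightarrow> bool" where
  "stoch_integral_well_defined M \<xi> T \<longleftrightarrow>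
     (\<forall>f\<in>L2_on T. (\<exists>X. has_stoch_integral M \<xi> T f X) \<and>
        (\<forall>X Y. has_stoch_integral M \<xi> T f X \<and> has_stoch_integral M \<xi> T f Y \<longrightarrow>
               (AE \<omega> in M. X \<omega> = Y \<omega>)))"

definition stoch_integral ::
    "'w measure \<Rightarrow> (real \<Rightarrow> 'w \<Rightarrow> real) \<Rightarrow> real \<Rightarrow> (real \<Rightarrow> real) \<Rightarrow> 'w \<Rightarrow> real" where
  "stoch_integral M \<xi> T f = (SOME X. has_stoch_integral M \<xi> T f X)"


section \<open>The regression model\<close>

definition gaussian_noise :: "'w measure \<Rightarrow> (real \<Rightarrow> 'w \<Rightarrow> real) \<Rightarrow> bool" where
  "gaussian_noise M \<xi> \<longleftrightarrow>
     (AE \<omega> in M. continuous_on {0..} (\<lambda>t. \<xi> t \<omega>)) \<and>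
     gaussian_family M {0..} \<xi> \<and>
     (\<forall>t\<ge>0. integral\<^sup>L M (\<xi> t) = 0) \<and>
     (\<forall>n::nat. n \<ge> 1 \<longrightarrow> stoch_integral_well_defined M \<xi> (real n))"

text \<open>The equation \<open>dy\<^sub>t = S(t) dt + d\<xi>\<^sub>t\<close> in integrated form, with any random
  initial value.\<close>

definition observed_process ::
    "'w measure \<Rightarrow> (real \<Rightarrow> real) \<Rightarrow> (real \<Rightarrow> 'w \<Rightarrow> real) \<Rightarrow> (real \<Rightarrow> 'w \<Rightarrow> real) \<Rightarrow> bool" where
  "observed_process M S \<xi> y \<longleftrightarrow> y 0 \<in> borel_measurable M \<and>
     (\<forall>t\<ge>0. \<forall>\<omega>\<in>space M.
        y t \<omega> = y 0 \<omega> + (LINT s:{0..t}|lebesgue. S s) + (\<xi> t \<omega> - \<xi> 0 \<omega>))"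

definition stoch_integral_dy ::
    "'w measure \<Rightarrow> (real \<Rightarrow> real) \<Rightarrow> (real \<Rightarrow> 'w \<Rightarrow> real) \<Rightarrow> real \<Rightarrow> (real \<Rightarrow> real) \<Rightarrow> 'w \<Rightarrow> real" where
  "stoch_integral_dy M S \<xi> T x \<omega> =
     (LINT t:{0..T}|lebesgue. x t * S t) + stoch_integral M \<xi> T x \<omega>"

definition zeta ::
    "'w measure \<Rightarrow> (real \<Rightarrow> 'w \<Rightarrow> real) \<Rightarrow> (nat \<Rightarrow> real \<Rightarrow> real) \<Rightarrow> nat \<Rightarrow> nat \<Rightarrow> 'w \<Rightarrow> real" where
  "zeta M \<xi> \<phi> n j \<omega> = 1 / sqrt (real n) * stoch_integral M \<xi> (real n) (\<phi> j) \<omega>"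

text \<open>Matrix indices start at 0, whereas the components of \<open>\<zeta>(n)\<close> are numbered from 1.\<close>

definition cov_mat ::
    "'w measure \<Rightarrow> (real \<Rightarrow> 'w \<Rightarrow> real) \<Rightarrow> (nat \<Rightarrow> real \<Rightarrow> real) \<Rightarrow> nat \<Rightarrow> nat \<Rightarrow> real mat" where
  "cov_mat M \<xi> \<phi> k n =
     mat k k (\<lambda>(i, j). \<integral>\<omega>. zeta M \<xi> \<phi> n (Suc i) \<omega> * zeta M \<xi> \<phi> n (Suc j) \<omega> \<partial>M)"

definition lambda_max :: "real mat \<Rightarrow> real" where
  "lambda_max A = Max {e. eigenvalue A e}"


section \<open>Model selection\<close>

text \<open>The paths on \<open>[0,n]\<close> carry the \<open>\<sigma>\<close>-algebra generated by the evaluations. A map into the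
  finite-dimensional space \<open>D_space \<phi> m\<close> is measurable iff all scalar products with it are.\<close>

definition projective_estimators ::
    "(nat \<Rightarrow> real \<Rightarrow> real) \<Rightarrow> nat \<Rightarrow> nat set set \<Rightarrow>
     (nat set \<Rightarrow> (real \<Rightarrow> real) \<Rightarrow> (real \<Rightarrow> real)) \<Rightarrow> bool" where
  "projective_estimators \<phi> n \<M> est \<longleftrightarrow>
     (\<forall>m\<in>\<M>.
        (\<forall>p\<in>space (Pi\<^sub>M {0..real n} (\<lambda>_. borel)). est m p \<in> D_space \<phi> m) \<and>
        (\<forall>x\<in>L2_per. (\<lambda>p. ip (est m p) x) \<in> borel_measurable (Pi\<^sub>M {0..real n} (\<lambda>_. borel))))"

definition estimate ::
    "nat \<Rightarrow> (real \<Rightarrow> 'w \<Rightarrow> real) \<Rightarrow> ((real \<Rightarrow> real) \<Rightarrow> (real \<Rightarrow> real)) \<Rightarrow> 'w \<Rightarrow> real \<Rightarrow> real" where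
  "estimate n y e \<omega> = e (\<lambda>t\<in>{0..real n}. y t \<omega>)"

text \<open>The contrast of a (possibly random) \<open>x \<in> D_space \<phi> m\<close>, whose coefficients with respect to
  the orthonormal functions \<open>\<phi> j\<close> are the scalar products \<open>ip x (\<phi> j)\<close>.\<close>

definition contrast ::
    "'w measure \<Rightarrow> (real \<Rightarrow> real) \<Rightarrow> (real \<Rightarrow> 'w \<Rightarrow> real) \<Rightarrow> (nat \<Rightarrow> real \<Rightarrow> real) \<Rightarrow> nat \<Rightarrow>
     nat set \<Rightarrow> (real \<Rightarrow> real) \<Rightarrow> 'w \<Rightarrow> real" where
  "contrast M S \<xi> \<phi> n m x \<omega> =
     normsq x - 2 / real n * (\<Sum>j\<in>m. ip x (\<phi> j) * stoch_integral_dy M S \<xi> (real n) (\<phi> j) \<omega>)"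

text \<open>Positivity of \<open>z\<close> is required explicitly because \<open>ln\<close> is total.\<close>

definition z_star :: real where
  "z_star = (GREATEST z. 0 < z \<and> ln z = z - 2)"

definition l_star :: "nat set set \<Rightarrow> (nat set \<Rightarrow> real) \<Rightarrow> real" where
  "l_star \<M> l = (\<Sum>m\<in>\<M>. exp (- l m * real (card m)))"

definition penalty :: "real \<Rightarrow> (nat set \<Rightarrow> real) \<Rightarrow> nat \<Rightarrow> nat set \<Rightarrow> real" where
  "penalty lam l n m =
     (4 * lam * (z_star\<^sup>2 / (z_star - 1))) * (l m * real (card m) / real n)"

text \<open>\<open>\<kappa>\<close> is any measurable choice of a minimiser; nothing is prescribed about ties.\<close>

definition selects_model ::
    "'w measure \<Rightarrow> (real \<Rightarrow> real) \<Rightarrow> (real \<Rightarrow> 'w \<Rightarrow> real) \<Rightarrow> (real \<Rightarrow> 'w \<Rightarrow> real) \<Rightarrow>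
     (nat \<Rightarrow> real \<Rightarrow> real) \<Rightarrow> nat \<Rightarrow> nat set set \<Rightarrow> real \<Rightarrow> (nat set \<Rightarrow> real) \<Rightarrow>
     (nat set \<Rightarrow> (real \<Rightarrow> real) \<Rightarrow> (real \<Rightarrow> real)) \<Rightarrow> ('w \<Rightarrow> nat set) \<Rightarrow> bool" where
  "selects_model M S \<xi> y \<phi> n \<M> lam l est \<kappa> \<longleftrightarrow>
     \<kappa> \<in> measurable M (count_space \<M>) \<and>
     (AE \<omega> in M. is_arg_min
        (\<lambda>m. contrast M S \<xi> \<phi> n m (estimate n y (est m) \<omega>) \<omega> + penalty lam l n m)
        (\<lambda>m. m \<in> \<M>) (\<kappa> \<omega>))"

text \<open>Risks may be infinite, hence the values in \<^typ>\<open>ennreal\<close>.\<close>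

definition risk :: "'w measure \<Rightarrow> (real \<Rightarrow> real) \<Rightarrow> ('w \<Rightarrow> real \<Rightarrow> real) \<Rightarrow> ennreal" where
  "risk M S X = (\<integral>\<^sup>+\<omega>. ennreal (normsq (\<lambda>t. X \<omega> t - S t)) \<partial>M)"

definition a_tilde ::
    "'w measure \<Rightarrow> (real \<Rightarrow> real) \<Rightarrow> (real \<Rightarrow> 'w \<Rightarrow> real) \<Rightarrow> nat \<Rightarrow> real \<Rightarrow> (nat set \<Rightarrow> real) \<Rightarrow>
     (nat set \<Rightarrow> (real \<Rightarrow> real) \<Rightarrow> (real \<Rightarrow> real)) \<Rightarrow> nat set \<Rightarrow> ennreal" where
  "a_tilde M S y n lam l est m =
     3 * risk M S (estimate n y (est m)) +
     ennreal (16 * lam * z_star * (real (card m) * l m / real n))"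

definition tau_0 :: "nat set set \<Rightarrow> (nat set \<Rightarrow> real) \<Rightarrow> real" where
  "tau_0 \<M> l = 16 * l_star \<M> l * z_star / (z_star - 1)"

end

theory Submission
  imports Defs
begin

text \<open>
  Write \<open>m\<close> for a competing model, \<open>k\<close> for the selected one, \<open>z\<close> for \<open>z_star\<close>, \<open>d\<^sub>m\<close> for \<open>card m\<close>. Since \<open>n\<close> is an
  integer and the functions are periodic, the contrast of an estimator is its loss, up to an additive
  constant and a term linear in the noise \<open>\<zeta>\<close>. Comparing the contrasts of \<open>k\<close> and \<open>m\<close> and applying AM-GM
  coefficientwise on \<open>m \<union> k\<close> bounds the loss of \<open>k\<close> by three times the loss of \<open>m\<close> plus
  \<open>2 * (P(m) - P(k)) + 8 / n * U\<close>, where \<open>U\<close> is the sum of the \<open>\<zeta>\<^sub>j\<^sup>2\<close> over \<open>m \<union> k\<close>. As the covariance of \<open>\<zeta>\<close> is at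
  most \<open>\<lambda>\<close>, the expectation of \<open>exp (a * U)\<close> for \<open>a = (z - 1) / (2 * z * \<lambda>)\<close> is at most \<open>z\<close> to the power
  \<open>(d\<^sub>m + d\<^sub>k) / 2\<close>, and \<open>ln z = z - 2\<close> makes the penalty absorb this power and leave a factor
  \<open>exp (- l\<^sub>k * d\<^sub>k)\<close>, which is summed over all models.
\<close>

section \<open>Square integrable functions\<close>

lemma integrable_mult_of_squares:
  fixes f g :: "'a \<Rightarrow> real"
  assumes [measurable]: "f \<in> borel_measurable M" "g \<in> borel_measurable M"
    and "integrable M (\<lambda>x. (f x)\<^sup>2)" "integrable M (\<lambda>x. (g x)\<^sup>2)"
  shows "integrable M (\<lambda>x. f x * g x)"
proof (rule Bochner_Integration.integrable_bound)
  show "integrable M (\<lambda>x. (f x)\<^sup>2 + (g x)\<^sup>2)" using assms by simp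
  have "\<bar>a * b\<bar> \<le> a\<^sup>2 + b\<^sup>2" for a b :: real
  proof -
    have "0 \<le> (\<bar>a\<bar> - \<bar>b\<bar>)\<^sup>2" by simp
    hence "2 * (\<bar>a\<bar> * \<bar>b\<bar>) \<le> a\<^sup>2 + b\<^sup>2" by (simp add: power2_diff)
    moreover have "0 \<le> \<bar>a\<bar> * \<bar>b\<bar>" by simp
    ultimately have "\<bar>a\<bar> * \<bar>b\<bar> \<le> a\<^sup>2 + b\<^sup>2" by linarith
    thus ?thesis by (simp add: abs_mult)
  qed
  thus "AE x in M. norm (f x * g x) \<le> norm ((f x)\<^sup>2 + (g x)\<^sup>2)" by simp
qed measurable

lemma L2_on_mult:
  assumes f: "f \<in> L2_on T" and g: "g \<in> L2_on T"
  shows "set_integrable lebesgue {0..T} (\<lambda>t. f t * g t)"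
proof -
  \<comment> \<open>An indicator equals its own square, so cutting off before or after squaring is
    the same. The cut-off is kept because measurability is known only on the interval.\<close>
  have sq: "(\<lambda>t. (indicat_real {0..T} t * h t)\<^sup>2) = (\<lambda>t. indicat_real {0..T} t * (h t)\<^sup>2)" for h
    by (auto simp: indicator_def)
  have "integrable lebesgue (\<lambda>t. (indicat_real {0..T} t * f t) * (indicat_real {0..T} t * g t))"
    using f g
    by (intro integrable_mult_of_squares)
      (auto simp: L2_on_def set_borel_measurable_def set_integrable_def sq)
  also have "(\<lambda>t. (indicat_real {0..T} t * f t) * (indicat_real {0..T} t * g t)) =
      (\<lambda>t. indicat_real {0..T} t * (f t * g t))"
    by (auto simp: indicator_def)
  finally show ?thesis by (simp add: set_integrable_def)
qed

lemma L2_on_add: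
  assumes f: "f \<in> L2_on T" and g: "g \<in> L2_on T"
  shows "(\<lambda>t. f t + g t) \<in> L2_on T"
proof -
  have "set_borel_measurable lebesgue {0..T} (\<lambda>t. f t + g t)"
    using f g unfolding L2_on_def set_borel_measurable_def
    by (auto simp: distrib_left intro!: borel_measurable_add)
  moreover have "set_integrable lebesgue {0..T} (\<lambda>t. (f t)\<^sup>2 + 2 * (f t * g t) + (g t)\<^sup>2)"
    using f g L2_on_mult[OF f g] by (intro set_integral_add set_integrable_mult_right) (auto simp: L2_on_def)
  ultimately show ?thesis by (simp add: L2_on_def power2_sum mult.assoc ac_simps)
qed

lemma L2_on_scale:
  assumes f: "f \<in> L2_on T"
  shows "(\<lambda>t. c * f t) \<in> L2_on T"
proof -
  have "(\<lambda>t. c * (indicat_real {0..T} t * f t)) \<in> borel_measurable lebesgue"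
    using f unfolding L2_on_def set_borel_measurable_def by auto
  thus ?thesis
    using f unfolding L2_on_def set_borel_measurable_def
    by (auto simp: power_mult_distrib mult.left_commute)
qed

lemma L2_on_zero: "(\<lambda>t. 0) \<in> L2_on T"
  by (simp add: L2_on_def set_borel_measurable_def set_integrable_def)

lemma L2_on_diff: "f \<in> L2_on T \<Longrightarrow> g \<in> L2_on T \<Longrightarrow> (\<lambda>t. f t - g t) \<in> L2_on T"
  using L2_on_add[of f T "\<lambda>t. - 1 * g t"] L2_on_scale[of g T "- 1"] by simp

lemma L2_on_sum: "(\<And>j. j \<in> J \<Longrightarrow> f j \<in> L2_on T) \<Longrightarrow> (\<lambda>t. \<Sum>j\<in>J. c j * f j t) \<in> L2_on T"
  by (induction J rule: infinite_finite_induct) (auto simp: L2_on_zero intro!: L2_on_add L2_on_scale)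

section \<open>Scalar product and squared norm over one period\<close>

lemma ip_commute: "ip x y = ip y x"
  by (simp add: ip_def mult.commute)

lemma ip_add_left:
  assumes "f \<in> L2_on 1" "g \<in> L2_on 1" "h \<in> L2_on 1"
  shows "ip (\<lambda>t. f t + g t) h = ip f h + ip g h"
  unfolding ip_def distrib_right using assms by (intro set_integral_add L2_on_mult)

lemma ip_scale_left: "ip (\<lambda>t. c * f t) h = c * ip f h"
  by (simp add: ip_def mult.assoc)

lemma ip_diff_left:
  assumes "f \<in> L2_on 1" "g \<in> L2_on 1" "h \<in> L2_on 1"
  shows "ip (\<lambda>t. f t - g t) h = ip f h - ip g h"
  using ip_add_left[of f "\<lambda>t. - 1 * g t" h] ip_scale_left[of "- 1" g h] L2_on_scale[of g 1 "- 1"] assms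
  by simp

lemma ip_sum_left:
  assumes "\<And>j. j \<in> J \<Longrightarrow> f j \<in> L2_on 1" "h \<in> L2_on 1"
  shows "ip (\<lambda>t. \<Sum>j\<in>J. c j * f j t) h = (\<Sum>j\<in>J. c j * ip (f j) h)"
  using assms(1)
proof (induction J rule: infinite_finite_induct)
  case (insert j J)
  thus ?case using assms(2)
    by (simp add: ip_add_left L2_on_scale L2_on_sum ip_scale_left)
qed (auto simp: ip_def)

lemma ip_add_right:
  assumes "f \<in> L2_on 1" "g \<in> L2_on 1" "h \<in> L2_on 1"
  shows "ip h (\<lambda>t. f t + g t) = ip h f + ip h g"
  unfolding ip_commute[of h] by (rule ip_add_left[OF assms])

lemma ip_diff_right:
  assumes "f \<in> L2_on 1" "g \<in> L2_on 1" "h \<in> L2_on 1"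
  shows "ip h (\<lambda>t. f t - g t) = ip h f - ip h g"
  unfolding ip_commute[of h] by (rule ip_diff_left[OF assms])

lemma ip_scale_right: "ip h (\<lambda>t. c * f t) = c * ip h f"
  unfolding ip_commute[of h] by (rule ip_scale_left)

lemma normsq_nonneg: "normsq x \<ge> 0"
  by (auto simp: normsq_def ip_def set_lebesgue_integral_def indicator_def intro!: integral_nonneg_AE)

lemma normsq_diff:
  assumes "f \<in> L2_on 1" "g \<in> L2_on 1"
  shows "normsq (\<lambda>t. f t - g t) = normsq f - 2 * ip f g + normsq g"
  using assms
  by (simp add: normsq_def ip_diff_left ip_diff_right L2_on_diff ip_commute[of g f])

text \<open>Parallelogram law for u = f - h and v = g - h: the right side minus the left side is the
  squared norm of u + v = f + g - 2h.\<close>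

lemma normsq_diff_le:
  assumes f: "f \<in> L2_on 1" and g: "g \<in> L2_on 1" and h: "h \<in> L2_on 1"
  shows "normsq (\<lambda>t. f t - g t) \<le> 2 * normsq (\<lambda>t. f t - h t) + 2 * normsq (\<lambda>t. g t - h t)"
proof -
  have "0 \<le> normsq (\<lambda>t. (f t + g t) - 2 * h t)" by (rule normsq_nonneg)
  also have "\<dots> = normsq (\<lambda>t. f t + g t) - 2 * ip (\<lambda>t. f t + g t) (\<lambda>t. 2 * h t) + normsq (\<lambda>t. 2 * h t)"
    using f g h by (intro normsq_diff L2_on_add L2_on_scale)
  also have "ip (\<lambda>t. f t + g t) (\<lambda>t. 2 * h t) = 2 * (ip f h + ip g h)"
    using f g h by (simp only: ip_scale_right ip_add_left)
  also have "normsq (\<lambda>t. 2 * h t) = 4 * normsq h"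
    by (simp add: normsq_def ip_scale_left ip_scale_right)
  also have "normsq (\<lambda>t. f t + g t) = normsq f + 2 * ip f g + normsq g"
    using f g by (simp add: normsq_def ip_add_left ip_add_right L2_on_add ip_commute[of g f])
  finally show ?thesis using f g h by (simp add: normsq_diff)
qed

section \<open>Expansions in an orthonormal system\<close>

lemma orthonormal_system_L2: "orthonormal_system \<phi> \<Longrightarrow> j \<ge> 1 \<Longrightarrow> \<phi> j \<in> L2_on 1"
  by (simp add: orthonormal_system_def L2_per_def)

lemma ip_orthonormal_sum:
  assumes \<phi>: "orthonormal_system \<phi>" and "finite m" "m \<subseteq> {1..}" "j \<ge> 1"
  shows "ip (\<lambda>t. \<Sum>i\<in>m. c i * \<phi> i t) (\<phi> j) = (if j \<in> m then c j else 0)"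
proof -
  have "ip (\<lambda>t. \<Sum>i\<in>m. c i * \<phi> i t) (\<phi> j) = (\<Sum>i\<in>m. c i * ip (\<phi> i) (\<phi> j))"
    using assms by (intro ip_sum_left) (auto intro!: orthonormal_system_L2[OF \<phi>])
  also have "\<dots> = (\<Sum>i\<in>m. if i = j then c i else 0)"
    using assms(3,4) \<phi>[unfolded orthonormal_system_def, THEN conjunct2, rule_format, of _ j]
    by (intro sum.cong) (auto simp: subset_iff)
  also have "\<dots> = (if j \<in> m then c j else 0)" using assms(2) by simp
  finally show ?thesis .
qed

lemma normsq_orthonormal_sum:
  assumes \<phi>: "orthonormal_system \<phi>" and m: "finite m" "m \<subseteq> {1..}"
  shows "normsq (\<lambda>t. \<Sum>i\<in>m. c i * \<phi> i t) = (\<Sum>i\<in>m. (c i)\<^sup>2)"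
proof -
  let ?x = "\<lambda>t. \<Sum>i\<in>m. c i * \<phi> i t"
  have "normsq ?x = (\<Sum>i\<in>m. c i * ip (\<phi> i) ?x)"
    unfolding normsq_def using m
    by (intro ip_sum_left L2_on_sum) (auto intro!: orthonormal_system_L2[OF \<phi>])
  also have "\<dots> = (\<Sum>i\<in>m. (c i)\<^sup>2)"
    using m ip_orthonormal_sum[OF \<phi> m]
    by (intro sum.cong) (auto simp: ip_commute[of _ ?x] power2_eq_square)
  finally show ?thesis .
qed

section \<open>Periodic functions\<close>

lemma periodic_add_nat:
  fixes f :: "real \<Rightarrow> real"
  assumes "\<And>t. f (t + 1) = f t" shows "f (t + real k) = f t"
proof (induction k)
  case (Suc k)
  have "f (t + real (Suc k)) = f ((t + real k) + 1)" by (rule arg_cong[of _ _ f]) simp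
  thus ?case using assms[of "t + real k"] Suc by simp
qed simp

lemma periodic_diff_nat:
  fixes f :: "real \<Rightarrow> real"
  assumes "\<And>t. f (t + 1) = f t" shows "f (t - real k) = f t"
  using periodic_add_nat[of f "t - real k" k] assms by simp

text \<open>Translates of the restriction to one period are glued together by induction. Half-open
  intervals keep the pieces disjoint, so that the indicators add up exactly.\<close>

lemma set_borel_measurable_periodic:
  fixes f :: "real \<Rightarrow> real"
  assumes per: "\<And>t. f (t + 1) = f t" and f: "set_borel_measurable lebesgue {0..1} f"
  shows "set_borel_measurable lebesgue {0..real k} f"
proof -
  let ?g = "\<lambda>t. indicat_real {0..1} t * f t"
  have g: "?g \<in> borel_measurable lebesgue" using f by (simp add: set_borel_measurable_def)
  have "set_borel_measurable lebesgue {0..<real k} f"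
  proof (induction k)
    case 0 show ?case by (simp add: set_borel_measurable_def)
  next
    case (Suc k)
    have "(\<lambda>t. ?g (- real k + 1 *\<^sub>R t)) \<in> borel_measurable lebesgue"
      using g by (intro borel_measurable_affine) auto
    hence "(\<lambda>t. indicat_real {0..<real k} t * f t + indicator {real k..<real k + 1} t * ?g (- real k + 1 *\<^sub>R t)) \<in> borel_measurable lebesgue"
      using Suc
      by (intro borel_measurable_add borel_measurable_times[of "indicator {real k..<real k + 1}"])
        (auto simp: set_borel_measurable_def intro!: borel_measurable_indicator)
    also have "(\<lambda>t. indicat_real {0..<real k} t * f t + indicator {real k..<real k + 1} t * ?g (- real k + 1 *\<^sub>R t)) =
        (\<lambda>t. indicat_real {0..<real (Suc k)} t * f t)"
      using periodic_diff_nat[of f, OF per] by (auto simp: indicator_def fun_eq_iff)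
    finally show ?case by (simp add: set_borel_measurable_def)
  qed
  \<comment> \<open>The right endpoint is restored separately; on a single point any value gives a
    measurable summand.\<close>
  hence "(\<lambda>t. indicat_real {0..<real k} t * f t + indicator {real k} t * f (real k)) \<in> borel_measurable lebesgue"
    by (intro borel_measurable_add borel_measurable_times[of "indicator {real k}"])
      (auto simp: set_borel_measurable_def intro!: borel_measurable_indicator)
  also have "(\<lambda>t. indicat_real {0..<real k} t * f t + indicator {real k} t * f (real k)) =
      (\<lambda>t. indicat_real {0..real k} t * f t)"
    by (auto simp: indicator_def fun_eq_iff)
  finally show ?thesis by (simp add: set_borel_measurable_def)
qed

lemma periodic_integral:
  fixes f :: "real \<Rightarrow> real"
  assumes per: "\<And>t. f (t + 1) = f t" and f: "set_integrable lebesgue {0..1} f"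
  shows "set_integrable lebesgue {0..real k} f"
    and "(LINT t:{0..real k}|lebesgue. f t) = real k * (LINT t:{0..1}|lebesgue. f t)"
proof -
  let ?I = "LINT t:{0..1}|lebesgue. f t"
  have null: "AE t in lebesgue. t \<noteq> (a::real)" for a
    by (rule AE_completion) (rule AE_lborel_singleton)
  have meas: "set_borel_measurable lebesgue {0..real k} f" for k
    using set_borel_measurable_periodic[of f k] per f by (auto simp: set_integrable_def set_borel_measurable_def)
  have "has_bochner_integral lebesgue (\<lambda>t. indicator {0..real k} t *\<^sub>R f t) (real k * ?I)"
  proof (induction k)
    case 0
    have "has_bochner_integral lebesgue (\<lambda>t::real. 0::real) 0" by (rule has_bochner_integral_zero)
    \<comment> \<open>The interval \<open>{0..0}\<close> still contains a point, so the integrand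
      vanishes only almost everywhere.\<close>
    moreover have "AE t in lebesgue. indicator {0..real 0} t *\<^sub>R f t = 0"
      using null[of 0] by eventually_elim (auto simp: indicator_def)
    ultimately have "has_bochner_integral lebesgue (\<lambda>t. indicator {0..real 0} t *\<^sub>R f t) 0"
      using has_bochner_integral_cong_AE[OF meas[of 0, unfolded set_borel_measurable_def]
          borel_measurable_const, of 0 0] by blast
    thus ?case by simp
  next
    case (Suc k)
    have "has_bochner_integral lebesgue (\<lambda>t. indicator {0..1} t *\<^sub>R f t) ?I"
      using f by (simp add: has_bochner_integral_iff set_integrable_def set_lebesgue_integral_def)
    hence "has_bochner_integral lebesgue (\<lambda>t. indicator {0..1} (- real k + 1 * t) *\<^sub>R f (- real k + 1 * t)) ?I"
      using has_bochner_integral_lebesgue_real_affine_iff[of 1 "\<lambda>t. indicator {0..1} t *\<^sub>R f t" ?I "- real k"]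
      by simp
    also have "(\<lambda>t. indicator {0..1} (- real k + 1 * t) *\<^sub>R f (- real k + 1 * t)) =
        (\<lambda>t. indicator {real k..real k + 1} t *\<^sub>R f t)"
      using periodic_diff_nat[of f, OF per] by (auto simp: indicator_def fun_eq_iff)
    finally have 1: "has_bochner_integral lebesgue
        (\<lambda>t. indicator {0..real k} t *\<^sub>R f t + indicator {real k..real k + 1} t *\<^sub>R f t) (real k * ?I + ?I)"
      by (intro has_bochner_integral_add Suc)
    \<comment> \<open>Adjacent closed periods share the point \<open>real k\<close>, which is
      counted twice on the left; it is a null set.\<close>
    have "AE t in lebesgue. indicator {0..real k} t *\<^sub>R f t + indicator {real k..real k + 1} t *\<^sub>R f t =
        indicator {0..real (Suc k)} t *\<^sub>R f t"
      using null[of "real k"] by eventually_elim (auto simp: indicator_def)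
    hence "has_bochner_integral lebesgue (\<lambda>t. indicator {0..real (Suc k)} t *\<^sub>R f t) (real k * ?I + ?I)"
      using 1 has_bochner_integral_cong_AE[OF borel_measurable_has_bochner_integral[OF 1]
          meas[of "Suc k", unfolded set_borel_measurable_def]]
      by blast
    thus ?case by (simp only: of_nat_Suc distrib_right mult_1 add.commute)
  qed
  thus "set_integrable lebesgue {0..real k} f"
    and "(LINT t:{0..real k}|lebesgue. f t) = real k * ?I"
    by (auto simp: has_bochner_integral_iff set_integrable_def set_lebesgue_integral_def)
qed

lemma L2_per_imp_L2_on:
  assumes "f \<in> L2_per" shows "f \<in> L2_on (real k)"
proof -
  have per: "f (t + 1) = f t" for t using assms unfolding L2_per_def by blast
  have f: "set_borel_measurable lebesgue {0..1} f" "set_integrable lebesgue {0..1} (\<lambda>t. (f t)\<^sup>2)"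
    using assms unfolding L2_per_def L2_on_def by auto
  have "set_integrable lebesgue {0..real k} (\<lambda>t. (f t)\<^sup>2)"
    by (rule periodic_integral(1)) (simp_all only: per f)
  thus ?thesis
    using set_borel_measurable_periodic[of f k, OF per f(1)] unfolding L2_on_def by blast
qed

text \<open>This is where the integer length of the observation interval enters: it holds a whole
  number of periods, so the drift contributes that multiple of a scalar product.\<close>

lemma integral_mult_L2_per:
  assumes "f \<in> L2_per" "g \<in> L2_per"
  shows "(LINT t:{0..real k}|lebesgue. f t * g t) = real k * ip f g"
proof -
  have per: "f (t + 1) * g (t + 1) = f t * g t" for t using assms unfolding L2_per_def by simp
  show ?thesis unfolding ip_def
    by (rule periodic_integral(2)) (use assms in \<open>auto simp: L2_per_def intro: L2_on_mult\<close>)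
qed

section \<open>Quadratic forms and the largest eigenvalue\<close>

lemma quadratic_form_bounded:
  fixes C :: "real mat"
  assumes C: "C \<in> carrier_mat k k"
  obtains K where "K > 0" "\<And>x. x \<in> carrier_vec k \<Longrightarrow> \<bar>scalar_prod x (C *\<^sub>v x)\<bar> \<le> K * scalar_prod x x"
proof
  \<comment> \<open>The summand 1 keeps the constant positive even for the zero matrix, so that its
    inverse can serve as a step size later.\<close>
  let ?K = "1 + (\<Sum>i<k. \<Sum>j<k. \<bar>C $$ (i, j)\<bar>)"
  show "?K > 0" by (intro add_pos_nonneg sum_nonneg) auto
  fix x :: "real vec" assume x: "x \<in> carrier_vec k"
  have xx: "scalar_prod x x = (\<Sum>i<k. (vec_index x i)\<^sup>2)"
    using x by (simp add: scalar_prod_def power2_eq_square lessThan_atLeast0)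
  have nn: "0 \<le> scalar_prod x x" unfolding xx by (intro sum_nonneg) auto
  have le: "\<bar>vec_index x i * vec_index x j\<bar> \<le> scalar_prod x x" if "i < k" "j < k" for i j
  proof -
    have m: "(vec_index x p)\<^sup>2 \<le> scalar_prod x x" if "p < k" for p
      unfolding xx using that by (intro member_le_sum) auto
    have "0 \<le> (\<bar>vec_index x i\<bar> - \<bar>vec_index x j\<bar>)\<^sup>2" by simp
    hence "2 * \<bar>vec_index x i * vec_index x j\<bar> \<le> (vec_index x i)\<^sup>2 + (vec_index x j)\<^sup>2"
      by (simp add: power2_diff abs_mult)
    with m[OF that(1)] m[OF that(2)] show ?thesis by linarith
  qed
  have "scalar_prod x (C *\<^sub>v x) = (\<Sum>i<k. \<Sum>j<k. C $$ (i, j) * (vec_index x i * vec_index x j))"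
    using x C by (simp add: scalar_prod_def lessThan_atLeast0 sum_distrib_left ac_simps)
  also have "\<bar>\<dots>\<bar> \<le> (\<Sum>i<k. \<Sum>j<k. \<bar>C $$ (i, j)\<bar> * scalar_prod x x)"
    by (intro order.trans[OF sum_abs] sum_mono) (auto simp: abs_mult[of "C $$ _"] intro!: mult_left_mono le)
  also have "\<dots> \<le> ?K * scalar_prod x x"
    using nn by (simp add: sum_distrib_right distrib_right)
  finally show "\<bar>scalar_prod x (C *\<^sub>v x)\<bar> \<le> ?K * scalar_prod x x" .
qed

text \<open>Let y be the preimage of x under A. Testing the form at x + t y adds the cross term 2 t
  |x|^2 and a term of order t^2 that is controlled by a bound K for the form of the inverse. As the
  total is at most 0, the form at x itself must be strictly negative.\<close>

lemma negative_semidefinite_invertible_imp_definite: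
  fixes A :: "real mat"
  assumes A: "A \<in> carrier_mat k k" and sym: "transpose_mat A = A"
    and nsd: "\<And>x. x \<in> carrier_vec k \<Longrightarrow> scalar_prod x (A *\<^sub>v x) \<le> 0"
    and det: "Determinant.det A \<noteq> 0"
  obtains d where "d > 0" "\<And>x. x \<in> carrier_vec k \<Longrightarrow> scalar_prod x (A *\<^sub>v x) \<le> - d * scalar_prod x x"
proof -
  from det_non_zero_imp_unit[OF A det] obtain C where C: "C \<in> carrier_mat k k" "A * C = 1\<^sub>m k"
    by (auto simp: Units_def ring_mat_def)
  from quadratic_form_bounded[OF C(1)] obtain K where K: "K > 0"
    "\<And>x. x \<in> carrier_vec k \<Longrightarrow> \<bar>scalar_prod x (C *\<^sub>v x)\<bar> \<le> K * scalar_prod x x" by blast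
  have "scalar_prod x (A *\<^sub>v x) \<le> - (1 / K) * scalar_prod x x" if x: "x \<in> carrier_vec k" for x
  proof -
    define y where "y = C *\<^sub>v x"
    have y: "y \<in> carrier_vec k" using C x by (simp add: y_def)
    have Ay: "A *\<^sub>v y = x"
      using assoc_mult_mat_vec[OF A C(1) x] C(2) x by (simp add: y_def)
    have yAx: "scalar_prod y (A *\<^sub>v x) = scalar_prod x x"
    proof -
      have "scalar_prod y (A *\<^sub>v x) = scalar_prod (transpose_mat A *\<^sub>v y) x"
        using transpose_vec_mult_scalar[OF A x y] by simp
      thus ?thesis by (simp add: sym Ay)
    qed
    \<comment> \<open>This value maximises the gain 2 t - K t^2; the maximum is 1 / K.\<close>
    let ?t = "1 / K"
    have Axy: "A *\<^sub>v (x + ?t \<cdot>\<^sub>v y) = A *\<^sub>v x + ?t \<cdot>\<^sub>v x"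
      using A x y Ay by (simp add: mult_add_distrib_mat_vec[OF A] mult_mat_vec[OF A])
    have Ax: "A *\<^sub>v x \<in> carrier_vec k" using A x by simp
    have "0 \<ge> scalar_prod (x + ?t \<cdot>\<^sub>v y) (A *\<^sub>v (x + ?t \<cdot>\<^sub>v y))"
      using nsd x y by simp
    also have "scalar_prod (x + ?t \<cdot>\<^sub>v y) (A *\<^sub>v (x + ?t \<cdot>\<^sub>v y)) =
       scalar_prod x (A *\<^sub>v x) + 2 * ?t * scalar_prod x x + ?t\<^sup>2 * scalar_prod x y"
      unfolding Axy
      using x y Ax yAx by (simp add: add_scalar_prod_distrib[of _ k] scalar_prod_add_distrib[of _ k]
          comm_scalar_prod[of y k x] power2_eq_square distrib_left)
    finally have "scalar_prod x (A *\<^sub>v x) + 2 * ?t * scalar_prod x x + ?t\<^sup>2 * scalar_prod x y \<le> 0" .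
    moreover have "- (?t * scalar_prod x x) \<le> ?t\<^sup>2 * scalar_prod x y"
    proof -
      have "- (K * scalar_prod x x) \<le> scalar_prod x y" using K(2)[OF x] by (simp add: y_def)
      from mult_left_mono[OF this, of "?t\<^sup>2"] show ?thesis using K(1) by (simp add: power2_eq_square)
    qed
    ultimately show ?thesis by simp
  qed
  with K(1) show ?thesis by (intro that[of "1/K"]) auto
qed

text \<open>The least upper bound of the Rayleigh quotient is an eigenvalue: otherwise the shifted
  matrix would be negative semidefinite and invertible, hence negative definite.\<close>

lemma quadratic_form_le_lambda_max:
  fixes B :: "real mat"
  assumes B: "B \<in> carrier_mat k k" and sym: "transpose_mat B = B" and x: "x \<in> carrier_vec k"
  shows "scalar_prod x (B *\<^sub>v x) \<le> lambda_max B * scalar_prod x x"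
proof (cases "k = 0")
  \<comment> \<open>In dimension 0 there are no eigenvalues and \<open>lambda_max\<close> is an
    unspecified number, but both sides are 0.\<close>
  case True
  thus ?thesis using x B by (simp add: scalar_prod_def)
next
  case False
  have pos: "scalar_prod v v > 0" if "v \<in> carrier_vec k" "v \<noteq> 0\<^sub>v k" for v :: "real vec"
  proof -
    have e: "scalar_prod v v = (\<Sum>i<k. (vec_index v i)\<^sup>2)"
      using that by (simp add: scalar_prod_def power2_eq_square lessThan_atLeast0)
    have "\<exists>i<k. vec_index v i \<noteq> 0"
    proof (rule ccontr)
      assume "\<not> ?thesis"
      hence "v = 0\<^sub>v k" using that(1) by (intro eq_vecI) auto
      with that(2) show False by simp
    qed
    then obtain i where "i < k" "vec_index v i \<noteq> 0" by blast
    hence "(\<Sum>i<k. (vec_index v i)\<^sup>2) \<noteq> 0" by (subst sum_nonneg_eq_0_iff) auto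
    moreover have "(\<Sum>i<k. (vec_index v i)\<^sup>2) \<ge> 0" by (intro sum_nonneg) auto
    ultimately show ?thesis unfolding e by linarith
  qed
  define U where "U = {m. \<forall>v\<in>carrier_vec k. scalar_prod v (B *\<^sub>v v) \<le> m * scalar_prod v v}"
  obtain K where K: "\<And>v. v \<in> carrier_vec k \<Longrightarrow> \<bar>scalar_prod v (B *\<^sub>v v)\<bar> \<le> K * scalar_prod v v"
    using quadratic_form_bounded[OF B] by blast
  have "K \<in> U" using abs_le_D1[OF K] unfolding U_def by simp
  have low: "scalar_prod v (B *\<^sub>v v) / scalar_prod v v \<le> m"
    if "m \<in> U" "v \<in> carrier_vec k" "v \<noteq> 0\<^sub>v k" for m v
    using that pos[OF that(2,3)] by (auto simp: U_def divide_le_eq)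
  \<comment> \<open>A nonzero vector, available because k is positive, is what bounds
    \<open>U\<close> from below.\<close>
  have "vec_index (unit_vec k 0) 0 \<noteq> vec_index (0\<^sub>v k :: real vec) 0"
    using False by simp
  hence u: "unit_vec k 0 \<in> carrier_vec k" "unit_vec k 0 \<noteq> (0\<^sub>v k :: real vec)"
    by auto
  have bdd: "bdd_below U" using low[OF _ u] by (rule bdd_belowI)
  define \<mu> where "\<mu> = Inf U"
  have mu: "scalar_prod v (B *\<^sub>v v) \<le> \<mu> * scalar_prod v v" if v: "v \<in> carrier_vec k" for v
  proof (cases "v = 0\<^sub>v k")
    case True
    thus ?thesis using B by simp
  next
    case False
    have "scalar_prod v (B *\<^sub>v v) / scalar_prod v v \<le> \<mu>"
      unfolding \<mu>_def using \<open>K \<in> U\<close> low[OF _ v False] by (intro cInf_greatest) auto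
    thus ?thesis using pos[OF v False] by (simp add: divide_le_eq)
  qed
  let ?A = "char_matrix B \<mu>"
  have A: "?A \<in> carrier_mat k k" using B by simp
  have Av: "scalar_prod v (?A *\<^sub>v v) = scalar_prod v (B *\<^sub>v v) - \<mu> * scalar_prod v v"
    if v: "v \<in> carrier_vec k" for v
  proof -
    have "?A *\<^sub>v v = B *\<^sub>v v + (- \<mu>) \<cdot>\<^sub>v v"
      unfolding char_matrix_def using B v
      by (subst add_mult_distrib_mat_vec[of _ k k]) (auto intro!: eq_vecI)
    thus ?thesis using B v by (simp add: scalar_prod_add_distrib[of _ k])
  qed
  have "eigenvalue B \<mu>"
  proof (rule ccontr)
    assume "\<not> eigenvalue B \<mu>"
    hence det: "Determinant.det ?A \<noteq> 0" using eigenvalue_det[OF B] by simp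
    have symA: "transpose_mat ?A = ?A"
    proof (rule eq_matI)
      fix i j assume ij: "i < dim_row ?A" "j < dim_col ?A"
      have "B $$ (j, i) = B $$ (i, j)"
        using ij B sym index_transpose_mat(1)[of i B j] by (auto simp: char_matrix_def)
      thus "transpose_mat ?A $$ (i, j) = ?A $$ (i, j)"
        using ij B by (auto simp: char_matrix_def)
    qed (use A in auto)
    obtain d where d: "d > 0"
      "\<And>v. v \<in> carrier_vec k \<Longrightarrow> scalar_prod v (?A *\<^sub>v v) \<le> - d * scalar_prod v v"
      by (rule negative_semidefinite_invertible_imp_definite[OF A symA _ det])
         (use mu in \<open>auto simp: Av\<close>)
    have "\<mu> - d \<in> U" unfolding U_def using d(2) by (auto simp: Av algebra_simps)
    hence "\<mu> \<le> \<mu> - d" unfolding \<mu>_def using bdd by (intro cInf_lower)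
    with d(1) show False by simp
  qed
  hence "\<mu> \<le> lambda_max B"
    unfolding lambda_max_def using card_finite_spectrum(1)[OF B]
    by (intro Max_ge) (auto simp: spectrum_def)
  moreover have "0 \<le> scalar_prod x x"
    using x by (auto simp: scalar_prod_def intro!: sum_nonneg)
  ultimately show ?thesis using mu[OF x] by (meson mult_right_mono order.trans)
qed

section \<open>Gaussian variables\<close>

lemma (in prob_space) normal_rv_integrable:
  assumes "normal_rv M X"
  shows "integrable M X" and "integrable M (\<lambda>\<omega>. (X \<omega>)\<^sup>2)"
proof -
  have X[measurable]: "X \<in> borel_measurable M" using assms by (simp add: normal_rv_def)
  consider \<mu> \<sigma> where "0 < \<sigma>" "distributed M lborel X (\<lambda>x. ennreal (normal_density \<mu> \<sigma> x))"
    | \<mu> where "AE \<omega> in M. X \<omega> = \<mu>"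
    using assms by (auto simp: normal_rv_def)
  hence "integrable M (\<lambda>\<omega>. (X \<omega>)\<^sup>2)"
  proof cases
    case 1
    \<comment> \<open>The second moment is obtained from the central one through \<open>x\<^sup>2 =
      (x - \<mu>)\<^sup>2 + 2 * \<mu> * x - \<mu>\<^sup>2\<close>.\<close>
    have "integrable lborel (\<lambda>x. normal_density \<mu> \<sigma> x * (x - \<mu>)^2 + 2 * \<mu> * (normal_density \<mu> \<sigma> x * x)
        - \<mu>\<^sup>2 * normal_density \<mu> \<sigma> x)"
      using 1(1) by (intro Bochner_Integration.integrable_add Bochner_Integration.integrable_diff
          integrable_mult_right integrable_normal_moment integrable_normal_moment_nz_1
          integrable_normal_density)
    hence "integrable lborel (\<lambda>x. normal_density \<mu> \<sigma> x * x\<^sup>2)"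
      by (rule Bochner_Integration.integrable_cong[THEN iffD1, rotated 2])
        (auto simp: power2_eq_square algebra_simps)
    thus ?thesis using distributed_integrable[OF 1(2), of "\<lambda>x. x\<^sup>2"] by simp
  next
    case 2
    hence "AE \<omega> in M. \<mu>\<^sup>2 = (X \<omega>)\<^sup>2" by eventually_elim simp
    thus ?thesis using integrable_cong_AE_imp[of M "\<lambda>_. \<mu>\<^sup>2" "\<lambda>\<omega>. (X \<omega>)\<^sup>2"] by simp
  qed
  thus "integrable M (\<lambda>\<omega>. (X \<omega>)\<^sup>2)" "integrable M X"
    using square_integrable_imp_integrable[OF X] by auto
qed

section \<open>Exponential moments of normal variables\<close>

lemma nn_integral_normal_density: "\<sigma> > 0 \<Longrightarrow> (\<integral>\<^sup>+x. ennreal (normal_density \<mu> \<sigma> x) \<partial>lborel) = 1"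
  by (subst nn_integral_eq_integral) auto

text \<open>Completing the square: the exponential tilt moves the mean of the density to
  \<open>s * \<sigma>\<^sup>2\<close> and leaves a constant factor, which is the value of the
  integral.\<close>

lemma nn_integral_exp_normal_density:
  assumes "\<sigma> > 0"
  shows "(\<integral>\<^sup>+x. ennreal (normal_density 0 \<sigma> x) * ennreal (exp (s * x)) \<partial>lborel) =
    ennreal (exp (s\<^sup>2 * \<sigma>\<^sup>2 / 2))"
proof -
  have "normal_density 0 \<sigma> x * exp (s * x) = exp (s\<^sup>2 * \<sigma>\<^sup>2 / 2) * normal_density (s * \<sigma>\<^sup>2) \<sigma> x" for x
  proof -
    have "- (x - 0)\<^sup>2 / (2 * \<sigma>\<^sup>2) + s * x = s\<^sup>2 * \<sigma>\<^sup>2 / 2 + - (x - s * \<sigma>\<^sup>2)\<^sup>2 / (2 * \<sigma>\<^sup>2)"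
      using assms by (simp add: field_simps power2_eq_square)
    from arg_cong[OF this, of exp] show ?thesis
      by (simp only: normal_density_def exp_add) (simp add: ac_simps)
  qed
  hence "(\<integral>\<^sup>+x. ennreal (normal_density 0 \<sigma> x) * ennreal (exp (s * x)) \<partial>lborel) =
      (\<integral>\<^sup>+x. ennreal (exp (s\<^sup>2 * \<sigma>\<^sup>2 / 2)) * ennreal (normal_density (s * \<sigma>\<^sup>2) \<sigma> x) \<partial>lborel)"
    by (simp add: ennreal_mult''[symmetric])
  also have "\<dots> = ennreal (exp (s\<^sup>2 * \<sigma>\<^sup>2 / 2))"
    using assms by (simp add: nn_integral_cmult nn_integral_normal_density)
  finally show ?thesis .
qed

text \<open>The product is a multiple of the centred normal density with variance
  \<open>1 / (1 - 2 * b)\<close>; the multiple is the corresponding standard deviation.\<close>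

lemma nn_integral_exp_square_std_normal:
  assumes "2 * b < 1"
  shows "(\<integral>\<^sup>+x. ennreal (std_normal_density x) * ennreal (exp (b * x\<^sup>2)) \<partial>lborel) =
    ennreal (1 / sqrt (1 - 2 * b))"
proof -
  let ?s = "1 / sqrt (1 - 2 * b)"
  have s: "?s > 0" "?s\<^sup>2 = 1 / (1 - 2 * b)" using assms by (auto simp: power_divide)
  have "std_normal_density x * exp (b * x\<^sup>2) = ?s * normal_density 0 ?s x" for x
  proof -
    have "- (x - 0)\<^sup>2 / (2 * ?s\<^sup>2) = - x\<^sup>2 / 2 + b * x\<^sup>2"
      unfolding s(2) using assms by (simp add: field_simps)
    hence "normal_density 0 ?s x = 1 / sqrt (2 * pi * ?s\<^sup>2) * (exp (- x\<^sup>2 / 2) * exp (b * x\<^sup>2))"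
      unfolding normal_density_def by (simp only: exp_add)
    also have "sqrt (2 * pi * ?s\<^sup>2) = sqrt (2 * pi) * ?s"
      using s(1) by (subst real_sqrt_mult) simp
    finally show ?thesis
      using s(1) by (simp add: std_normal_density_def)
  qed
  hence "(\<integral>\<^sup>+x. ennreal (std_normal_density x) * ennreal (exp (b * x\<^sup>2)) \<partial>lborel) =
      (\<integral>\<^sup>+x. ennreal ?s * ennreal (normal_density 0 ?s x) \<partial>lborel)"
    using s(1) by (intro nn_integral_cong) (simp only: ennreal_mult''[symmetric] normal_density_nonneg exp_ge_zero)
  also have "\<dots> = ennreal ?s"
    using s(1) by (subst nn_integral_cmult) (auto simp: nn_integral_normal_density)
  finally show ?thesis .
qed

lemma (in prob_space) normal_rv_mgf:
  assumes X: "normal_rv M X" and mean: "expectation X = 0"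
  shows "(\<integral>\<^sup>+\<omega>. ennreal (exp (s * X \<omega>)) \<partial>M) = ennreal (exp (s\<^sup>2 * expectation (\<lambda>\<omega>. (X \<omega>)\<^sup>2) / 2))"
proof -
  have Xm[measurable]: "X \<in> borel_measurable M" using X by (simp add: normal_rv_def)
  consider \<mu> \<sigma> where "0 < \<sigma>" "distributed M lborel X (\<lambda>x. ennreal (normal_density \<mu> \<sigma> x))"
    | \<mu> where "AE \<omega> in M. X \<omega> = \<mu>"
    using X by (auto simp: normal_rv_def)
  thus ?thesis
  proof cases
    case 1
    have "\<mu> = 0" using normal_distributed_expectation[OF 1] mean by simp
    moreover have "expectation (\<lambda>\<omega>. (X \<omega>)\<^sup>2) = \<sigma>\<^sup>2"
      using normal_distributed_variance[OF 1] mean by simp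
    ultimately show ?thesis
      using distributed_nn_integral[OF 1(2), of "\<lambda>x. ennreal (exp (s * x))"]
        nn_integral_exp_normal_density[OF 1(1), of s] by simp
  next
    case 2
    \<comment> \<open>A constant variable with mean zero is zero, so both sides are 1 in the
      degenerate case.\<close>
    have "expectation X = expectation (\<lambda>_. \<mu>)" using 2 by (intro integral_cong_AE) auto
    hence "\<mu> = 0" using mean by (simp add: prob_space)
    hence X0: "AE \<omega> in M. X \<omega> = 0" using 2 by simp
    have "expectation (\<lambda>\<omega>. (X \<omega>)\<^sup>2) = expectation (\<lambda>_. 0)"
      using X0 by (intro integral_cong_AE) auto
    moreover have "(\<integral>\<^sup>+\<omega>. ennreal (exp (s * X \<omega>)) \<partial>M) = (\<integral>\<^sup>+\<omega>. 1 \<partial>M)"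
      using X0 by (intro nn_integral_cong_AE) auto
    ultimately show ?thesis by (simp add: emeasure_space_1)
  qed
qed

text \<open>Writing \<open>exp (a * \<bar>v\<bar>\<^sup>2)\<close> as the moment generating function of an independent
  standard Gaussian vector at \<open>sqrt (2 * a) * v\<close> makes it possible to integrate over \<open>\<omega>\<close> first;
  no diagonalisation of the covariance matrix is needed.\<close>

lemma (in prob_space) nn_integral_exp_sum_squares_le:
  fixes Z :: "'i \<Rightarrow> 'a \<Rightarrow> real"
  assumes F: "finite F" and Z[measurable]: "\<And>i. i \<in> F \<Longrightarrow> Z i \<in> borel_measurable M"
    and mgf: "\<And>c. (\<integral>\<^sup>+\<omega>. ennreal (exp (\<Sum>i\<in>F. c i * Z i \<omega>)) \<partial>M) \<le> ennreal (exp (v / 2 * (\<Sum>i\<in>F. (c i)\<^sup>2)))"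
    and a: "0 \<le> a" "2 * (a * v) < 1"
  shows "(\<integral>\<^sup>+\<omega>. ennreal (exp (a * (\<Sum>i\<in>F. (Z i \<omega>)\<^sup>2))) \<partial>M) \<le> ennreal ((1 / sqrt (1 - 2 * (a * v))) ^ card F)"
proof -
  define N where "N = density lborel (\<lambda>x. ennreal (std_normal_density x))"
  interpret N: prob_space N
    using prob_space_normal_density[of 1 0] by (simp add: N_def)
  interpret P: product_prob_space "\<lambda>_. N" by unfold_locales
  interpret PF: finite_product_prob_space "\<lambda>_. N" F by unfold_locales (rule F)
  interpret MP: pair_sigma_finite M "Pi\<^sub>M F (\<lambda>_. N)" by unfold_locales
  have [measurable_cong]: "sets N = sets borel" by (simp add: N_def)
  let ?r = "sqrt (2 * a)"
  have r: "?r\<^sup>2 = 2 * a" using a by simp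
  \<comment> \<open>Integrals over the independent coordinates factor. This serves twice: with
    linear \<open>h\<close> before the order of integration is exchanged, with quadratic
    \<open>h\<close> after it.\<close>
  have prod: "(\<integral>\<^sup>+g. ennreal (exp (\<Sum>i\<in>F. h i (g i))) \<partial>Pi\<^sub>M F (\<lambda>_. N)) =
      (\<Prod>i\<in>F. \<integral>\<^sup>+x. ennreal (exp (h i x)) \<partial>N)"
    if [measurable]: "\<And>i. i \<in> F \<Longrightarrow> h i \<in> borel_measurable borel" for h :: "'i \<Rightarrow> real \<Rightarrow> real"
    using P.product_nn_integral_prod[OF F, of "\<lambda>i x. ennreal (exp (h i x))"]
    by (simp add: exp_sum F prod_ennreal)
  have N1: "(\<integral>\<^sup>+x. ennreal (exp (s * x)) \<partial>N) = ennreal (exp (s\<^sup>2 / 2))" for s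
    unfolding N_def by (subst nn_integral_density) (auto simp: nn_integral_exp_normal_density)
  have "ennreal (exp (a * (\<Sum>i\<in>F. (Z i \<omega>)\<^sup>2))) =
      (\<integral>\<^sup>+g. ennreal (exp (\<Sum>i\<in>F. (?r * g i) * Z i \<omega>)) \<partial>Pi\<^sub>M F (\<lambda>_. N))" for \<omega>
  proof -
    have "(\<integral>\<^sup>+g. ennreal (exp (\<Sum>i\<in>F. (?r * g i) * Z i \<omega>)) \<partial>Pi\<^sub>M F (\<lambda>_. N)) =
        (\<Prod>i\<in>F. \<integral>\<^sup>+x. ennreal (exp ((?r * x) * Z i \<omega>)) \<partial>N)"
      by (rule prod) measurable
    also have "\<dots> = (\<Prod>i\<in>F. ennreal (exp (a * (Z i \<omega>)\<^sup>2)))"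
    proof (rule prod.cong[OF refl])
      fix i
      show "(\<integral>\<^sup>+x. ennreal (exp ((?r * x) * Z i \<omega>)) \<partial>N) = ennreal (exp (a * (Z i \<omega>)\<^sup>2))"
        using N1[of "?r * Z i \<omega>"] r by (simp add: power_mult_distrib ac_simps)
    qed
    finally show ?thesis by (simp add: prod_ennreal exp_sum[symmetric] F sum_distrib_left)
  qed
  hence "(\<integral>\<^sup>+\<omega>. ennreal (exp (a * (\<Sum>i\<in>F. (Z i \<omega>)\<^sup>2))) \<partial>M) =
      (\<integral>\<^sup>+\<omega>. \<integral>\<^sup>+g. ennreal (exp (\<Sum>i\<in>F. (?r * g i) * Z i \<omega>)) \<partial>Pi\<^sub>M F (\<lambda>_. N) \<partial>M)"
    by simp
  also have "\<dots> = (\<integral>\<^sup>+g. \<integral>\<^sup>+\<omega>. ennreal (exp (\<Sum>i\<in>F. (?r * g i) * Z i \<omega>)) \<partial>M \<partial>Pi\<^sub>M F (\<lambda>_. N))"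
    by (rule MP.Fubini'[symmetric]) measurable
  \<comment> \<open>For each fixed \<open>g\<close> the bound \<open>mgf\<close> is used with
    coefficients \<open>sqrt (2 * a) * g i\<close>. What remains is an exponential square moment of
    the auxiliary Gaussian vector.\<close>
  also have "\<dots> \<le> (\<integral>\<^sup>+g. ennreal (exp (\<Sum>i\<in>F. (a * v) * (g i)\<^sup>2)) \<partial>Pi\<^sub>M F (\<lambda>_. N))"
  proof (rule nn_integral_mono)
    fix g
    have "v / 2 * (\<Sum>i\<in>F. (?r * g i)\<^sup>2) = (\<Sum>i\<in>F. (a * v) * (g i)\<^sup>2)"
      unfolding power_mult_distrib r by (simp add: sum_distrib_left ac_simps)
    with mgf[of "\<lambda>i. ?r * g i"]
    show "(\<integral>\<^sup>+\<omega>. ennreal (exp (\<Sum>i\<in>F. (?r * g i) * Z i \<omega>)) \<partial>M) \<le> ennreal (exp (\<Sum>i\<in>F. (a * v) * (g i)\<^sup>2))"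
      by simp
  qed
  also have "\<dots> = (\<Prod>i\<in>F. \<integral>\<^sup>+x. ennreal (exp ((a * v) * x\<^sup>2)) \<partial>N)"
    by (rule prod) measurable
  also have "\<dots> = (\<Prod>i\<in>F. ennreal (1 / sqrt (1 - 2 * (a * v))))"
    unfolding N_def using a(2)
    by (intro prod.cong refl, subst nn_integral_density) (auto simp: nn_integral_exp_square_std_normal)
  also have "\<dots> = ennreal ((1 / sqrt (1 - 2 * (a * v))) ^ card F)"
    using a(2) by (simp add: ennreal_power)
  finally show ?thesis .
qed

section \<open>The normalised stochastic integrals\<close>

lemma gaussian_familyD:
  assumes "gaussian_family M J X" "i \<in> J" shows "normal_rv M (X i)"
  using assms(1)[unfolded gaussian_family_def, rule_format, of "{i}" "\<lambda>_. 1"] assms(2) by simp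

lemma (in prob_space) step_integral_mean_zero:
  assumes "gaussian_noise M \<xi>" "s \<in> steps_on T"
  shows "integrable M (step_integral \<xi> s)" and "expectation (step_integral \<xi> s) = 0"
proof -
  have \<xi>: "integrable M (\<xi> t)" "expectation (\<xi> t) = 0" if "t \<ge> 0" for t
    using assms(1) that gaussian_familyD[of M "{0..}" \<xi> t]
    by (auto simp: gaussian_noise_def intro: normal_rv_integrable)
  have "integrable M (step_integral \<xi> s) \<and> expectation (step_integral \<xi> s) = 0"
    using assms(2)
  proof (induction s)
    case Nil
    show ?case by (simp add: step_integral_def)
  next
    case (Cons p s)
    obtain a u v where p: "p = (a, u, v)" by (metis prod_cases3)
    have uv: "0 \<le> u" "0 \<le> v" and s: "s \<in> steps_on T" using Cons.prems by (auto simp: steps_on_def p)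
    have "step_integral \<xi> (p # s) = (\<lambda>\<omega>. a * (\<xi> v \<omega> - \<xi> u \<omega>) + step_integral \<xi> s \<omega>)"
      by (simp add: step_integral_def p fun_eq_iff)
    thus ?case using Cons.IH[OF s] \<xi>[OF uv(1)] \<xi>[OF uv(2)] by simp
  qed
  thus "integrable M (step_integral \<xi> s)" "expectation (step_integral \<xi> s) = 0" by auto
qed

text \<open>Step integrals are centred, so the mean of their difference from X is minus the mean of
  X. As a variance is nonnegative, the square of this mean is at most the mean square distance,
  which tends to 0.\<close>

lemma (in prob_space) has_stoch_integral_mean_zero:
  assumes noise: "gaussian_noise M \<xi>" and X: "has_stoch_integral M \<xi> T f X"
  shows "expectation X = 0"
proof -
  have Xm[measurable]: "X \<in> borel_measurable M" using X by (simp add: has_stoch_integral_def)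
  obtain s where s: "\<And>k. s k \<in> steps_on T"
    and lim: "(\<lambda>k::nat. \<integral>\<^sup>+\<omega>. ennreal ((step_integral \<xi> (s k) \<omega> - X \<omega>)\<^sup>2) \<partial>M) \<longlonglongrightarrow> 0"
    using X by (auto simp: has_stoch_integral_def)
  have bound: "ennreal ((expectation X)\<^sup>2) \<le> (\<integral>\<^sup>+\<omega>. ennreal ((step_integral \<xi> (s k) \<omega> - X \<omega>)\<^sup>2) \<partial>M)" for k
  proof (cases "(\<integral>\<^sup>+\<omega>. ennreal ((step_integral \<xi> (s k) \<omega> - X \<omega>)\<^sup>2) \<partial>M) < \<infinity>")
    \<comment> \<open>A finite distance makes X integrable, as the step integral minus the
      difference. An infinite distance makes the bound trivial.\<close>
    case True
    let ?S = "step_integral \<xi> (s k)"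
    note S = step_integral_mean_zero[OF noise s[of k]]
    have [measurable]: "?S \<in> borel_measurable M" using S(1) by auto
    have D2: "integrable M (\<lambda>\<omega>. (?S \<omega> - X \<omega>)\<^sup>2)"
      using True by (intro integrableI_nonneg) auto
    have D: "integrable M (\<lambda>\<omega>. ?S \<omega> - X \<omega>)"
      by (rule square_integrable_imp_integrable[OF _ D2]) measurable
    have "integrable M (\<lambda>\<omega>. ?S \<omega> - (?S \<omega> - X \<omega>))" using S(1) D by (rule Bochner_Integration.integrable_diff)
    hence Xi: "integrable M X" by simp
    have "0 \<le> variance (\<lambda>\<omega>. ?S \<omega> - X \<omega>)" by (rule variance_positive)
    also have "\<dots> = expectation (\<lambda>\<omega>. (?S \<omega> - X \<omega>)\<^sup>2) - (expectation (\<lambda>\<omega>. ?S \<omega> - X \<omega>))\<^sup>2"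
      by (rule variance_eq[OF D D2])
    also have "expectation (\<lambda>\<omega>. ?S \<omega> - X \<omega>) = - expectation X"
      using S Xi by simp
    finally show ?thesis using D2 by (subst nn_integral_eq_integral) auto
  next
    case False
    hence "(\<integral>\<^sup>+\<omega>. ennreal ((step_integral \<xi> (s k) \<omega> - X \<omega>)\<^sup>2) \<partial>M) = \<top>"
      by (simp add: not_less top_unique)
    thus ?thesis by simp
  qed
  have "ennreal ((expectation X)\<^sup>2) \<le> 0" by (rule LIMSEQ_le_const[OF lim]) (use bound in auto)
  thus ?thesis by simp
qed

text \<open>The second moment of a linear combination is the quadratic form of the covariance matrix
  at the coefficient vector, so the eigenvalue bound applies.\<close>

lemma (in prob_space) second_moment_le_lambda_max:
  assumes \<zeta>: "gaussian_family M {1..k} (zeta M \<xi> \<phi> n)"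
  shows "expectation (\<lambda>\<omega>. (\<Sum>i\<in>{1..k}. c i * zeta M \<xi> \<phi> n i \<omega>)\<^sup>2)
    \<le> lambda_max (cov_mat M \<xi> \<phi> k n) * (\<Sum>i\<in>{1..k}. (c i)\<^sup>2)"
proof -
  let ?B = "cov_mat M \<xi> \<phi> k n" and ?Z = "zeta M \<xi> \<phi> n"
  \<comment> \<open>Entry i holds the coefficient numbered i + 1, matching the shift in
    \<open>cov_mat\<close>.\<close>
  define x where "x = vec k (\<lambda>i. c (Suc i))"
  have Z: "normal_rv M (?Z (Suc i))" if "i < k" for i using gaussian_familyD[OF \<zeta>] that by simp
  have ZZ: "integrable M (\<lambda>\<omega>. ?Z (Suc i) \<omega> * ?Z (Suc j) \<omega>)" if "i < k" "j < k" for i j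
    using Z[OF that(1)] Z[OF that(2)]
    by (intro integrable_mult_of_squares normal_rv_integrable) (auto simp: normal_rv_def)
  have "(\<Sum>i\<in>{1..k}. c i * ?Z i \<omega>)\<^sup>2 =
      (\<Sum>i<k. \<Sum>j<k. (c (Suc i) * c (Suc j)) * (?Z (Suc i) \<omega> * ?Z (Suc j) \<omega>))" for \<omega>
    by (simp add: sum.atLeast1_atMost_eq power2_eq_square sum_product ac_simps)
  hence "expectation (\<lambda>\<omega>. (\<Sum>i\<in>{1..k}. c i * ?Z i \<omega>)\<^sup>2) =
      expectation (\<lambda>\<omega>. \<Sum>i<k. \<Sum>j<k. (c (Suc i) * c (Suc j)) * (?Z (Suc i) \<omega> * ?Z (Suc j) \<omega>))"
    by simp
  also have "\<dots> =
      (\<Sum>i<k. \<Sum>j<k. (c (Suc i) * c (Suc j)) * expectation (\<lambda>\<omega>. ?Z (Suc i) \<omega> * ?Z (Suc j) \<omega>))"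
  proof -
    have "expectation (\<lambda>\<omega>. \<Sum>i<k. \<Sum>j<k. (c (Suc i) * c (Suc j)) * (?Z (Suc i) \<omega> * ?Z (Suc j) \<omega>)) =
        (\<Sum>i<k. expectation (\<lambda>\<omega>. \<Sum>j<k. (c (Suc i) * c (Suc j)) * (?Z (Suc i) \<omega> * ?Z (Suc j) \<omega>)))"
      by (rule Bochner_Integration.integral_sum)
        (intro Bochner_Integration.integrable_sum integrable_mult_right ZZ; simp)
    also have "\<dots> = (\<Sum>i<k. \<Sum>j<k. expectation (\<lambda>\<omega>. (c (Suc i) * c (Suc j)) * (?Z (Suc i) \<omega> * ?Z (Suc j) \<omega>)))"
      by (intro sum.cong refl Bochner_Integration.integral_sum integrable_mult_right ZZ; simp)
    finally show ?thesis by (simp only: integral_mult_right_zero)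
  qed
  also have "\<dots> = (\<Sum>i<k. c (Suc i) * (\<Sum>j<k. expectation (\<lambda>\<omega>. ?Z (Suc i) \<omega> * ?Z (Suc j) \<omega>) * c (Suc j)))"
    unfolding sum_distrib_left by (intro sum.cong refl) (simp only: mult.assoc mult.commute)
  also have "\<dots> = scalar_prod x (?B *\<^sub>v x)"
    by (simp add: x_def cov_mat_def scalar_prod_def lessThan_atLeast0)
  also have "\<dots> \<le> lambda_max ?B * scalar_prod x x"
  proof (rule quadratic_form_le_lambda_max)
    show "transpose_mat ?B = ?B"
      by (rule eq_matI) (auto simp: cov_mat_def mult.commute)
  qed (auto simp: cov_mat_def x_def)
  also have "scalar_prod x x = (\<Sum>i\<in>{1..k}. (c i)\<^sup>2)"
    unfolding One_nat_def sum.atLeast1_atMost_eq by (simp add: x_def scalar_prod_def power2_eq_square lessThan_atLeast0)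
  finally show ?thesis .
qed

text \<open>A Gaussian family may have any means. Centring is inherited from the noise, because each
  \<open>\<phi> j\<close> lies in the domain of the stochastic integral by periodicity.\<close>

lemma (in prob_space) zeta_mean_zero:
  assumes noise: "gaussian_noise M \<xi>" and \<phi>: "orthonormal_system \<phi>" and "n \<ge> 1" "j \<ge> 1"
  shows "expectation (zeta M \<xi> \<phi> n j) = 0"
proof -
  have "\<phi> j \<in> L2_on (real n)"
    using \<phi> \<open>j \<ge> 1\<close> by (intro L2_per_imp_L2_on) (simp add: orthonormal_system_def)
  hence "\<exists>X. has_stoch_integral M \<xi> (real n) (\<phi> j) X"
    using noise \<open>n \<ge> 1\<close> by (simp add: gaussian_noise_def stoch_integral_well_defined_def)
  hence "has_stoch_integral M \<xi> (real n) (\<phi> j) (stoch_integral M \<xi> (real n) (\<phi> j))"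
    unfolding stoch_integral_def by (rule someI_ex)
  from has_stoch_integral_mean_zero[OF noise this] show ?thesis by (simp add: zeta_def[abs_def])
qed

lemma (in prob_space) zeta_mgf_le:
  assumes noise: "gaussian_noise M \<xi>" and \<phi>: "orthonormal_system \<phi>" and n: "n \<ge> 1"
    and gauss: "\<And>k. k \<ge> 1 \<Longrightarrow> gaussian_family M {1..k} (zeta M \<xi> \<phi> n)"
    and lam: "\<And>k. k \<ge> 1 \<Longrightarrow> lambda_max (cov_mat M \<xi> \<phi> k n) \<le> lam"
    and F: "finite F" "F \<subseteq> {1..}"
  shows "(\<integral>\<^sup>+\<omega>. ennreal (exp (\<Sum>i\<in>F. c i * zeta M \<xi> \<phi> n i \<omega>)) \<partial>M)
    \<le> ennreal (exp (lam / 2 * (\<Sum>i\<in>F. (c i)\<^sup>2)))"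
proof -
  \<comment> \<open>The covariance bounds concern initial segments, so the coefficients are padded
    with zeros up to \<open>k\<close>. Inserting 1 covers the empty \<open>F\<close>.\<close>
  define k where "k = Max (insert 1 F)"
  have k: "k \<ge> 1" "F \<subseteq> {1..k}" using F by (auto simp: k_def)
  define d where "d i = (if i \<in> F then c i else 0)" for i
  define Y where "Y \<omega> = (\<Sum>i\<in>{1..k}. d i * zeta M \<xi> \<phi> n i \<omega>)" for \<omega>
  have dz: "(\<Sum>i\<in>F. c i * zeta M \<xi> \<phi> n i \<omega>) = Y \<omega>" for \<omega>
    unfolding Y_def using k(2) by (intro sum.mono_neutral_cong_left) (auto simp: d_def)
  have dd: "(\<Sum>i\<in>F. (c i)\<^sup>2) = (\<Sum>i\<in>{1..k}. (d i)\<^sup>2)"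
    using k(2) by (intro sum.mono_neutral_cong_left) (auto simp: d_def)
  have Y: "normal_rv M Y"
    using gauss[OF k(1)] unfolding gaussian_family_def Y_def by blast
  have int: "integrable M (zeta M \<xi> \<phi> n i)" if "i \<in> {1..k}" for i
    by (rule normal_rv_integrable(1)[OF gaussian_familyD[OF gauss[OF k(1)] that]])
  have "expectation Y = (\<Sum>i\<in>{1..k}. expectation (\<lambda>\<omega>. d i * zeta M \<xi> \<phi> n i \<omega>))"
    unfolding Y_def by (intro Bochner_Integration.integral_sum integrable_mult_right int)
  also have "\<dots> = 0"
    using zeta_mean_zero[OF noise \<phi> n] by (intro sum.neutral) simp
  finally have "expectation Y = 0" .
  from normal_rv_mgf[OF Y this, of 1]
  have "(\<integral>\<^sup>+\<omega>. ennreal (exp (Y \<omega>)) \<partial>M) = ennreal (exp (expectation (\<lambda>\<omega>. (Y \<omega>)\<^sup>2) / 2))"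
    by simp
  also have "\<dots> \<le> ennreal (exp (lam / 2 * (\<Sum>i\<in>{1..k}. (d i)\<^sup>2)))"
  proof -
    have "expectation (\<lambda>\<omega>. (Y \<omega>)\<^sup>2) \<le> lambda_max (cov_mat M \<xi> \<phi> k n) * (\<Sum>i\<in>{1..k}. (d i)\<^sup>2)"
      unfolding Y_def by (rule second_moment_le_lambda_max[OF gauss[OF k(1)]])
    also have "\<dots> \<le> lam * (\<Sum>i\<in>{1..k}. (d i)\<^sup>2)"
      by (intro mult_right_mono lam k sum_nonneg) auto
    finally show ?thesis by (intro ennreal_leI) simp
  qed
  finally show ?thesis unfolding dz dd .
qed

section \<open>The pathwise inequality\<close>

text \<open>The drift turns the linear term into a scalar product with S, and completing the square
  produces the loss. The term \<open>normsq S\<close> is common to all models and cancels when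
  contrasts are compared.\<close>

lemma contrast_eq:
  assumes \<phi>: "orthonormal_system \<phi>" and S: "S \<in> L2_per" and n: "n \<ge> 1"
    and m: "finite m" "m \<subseteq> {1..}" and x: "x = (\<lambda>t. \<Sum>j\<in>m. c j * \<phi> j t)"
  shows "contrast M S \<xi> \<phi> n m x \<omega> =
    normsq (\<lambda>t. x t - S t) - normsq S - 2 / sqrt (real n) * (\<Sum>j\<in>m. c j * zeta M \<xi> \<phi> n j \<omega>)"
proof -
  have S1: "S \<in> L2_on 1" using S by (simp add: L2_per_def)
  have \<phi>1: "\<phi> j \<in> L2_on 1" "\<phi> j \<in> L2_per" if "j \<in> m" for j
    using \<phi> m that by (auto simp: orthonormal_system_def L2_per_def)
  have x1: "x \<in> L2_on 1" unfolding x by (intro L2_on_sum \<phi>1)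
  have I: "2 / real n * stoch_integral_dy M S \<xi> (real n) (\<phi> j) \<omega> =
      2 * ip (\<phi> j) S + 2 / sqrt (real n) * zeta M \<xi> \<phi> n j \<omega>" if "j \<in> m" for j
  proof -
    have "1 / sqrt (real n) * (1 / sqrt (real n)) = 1 / real n" by simp
    thus ?thesis
      using n by (simp add: stoch_integral_dy_def integral_mult_L2_per[OF \<phi>1(2)[OF that] S] zeta_def
          distrib_left)
  qed
  have "2 / real n * (\<Sum>j\<in>m. ip x (\<phi> j) * stoch_integral_dy M S \<xi> (real n) (\<phi> j) \<omega>) =
      (\<Sum>j\<in>m. c j * (2 / real n * stoch_integral_dy M S \<xi> (real n) (\<phi> j) \<omega>))"
    unfolding sum_distrib_left
  proof (rule sum.cong[OF refl])
    fix j assume j: "j \<in> m"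
    hence "ip x (\<phi> j) = c j" using ip_orthonormal_sum[OF \<phi> m, of j c] m by (auto simp: x)
    thus "2 / real n * (ip x (\<phi> j) * stoch_integral_dy M S \<xi> (real n) (\<phi> j) \<omega>) =
        c j * (2 / real n * stoch_integral_dy M S \<xi> (real n) (\<phi> j) \<omega>)" by simp
  qed
  also have "\<dots> = (\<Sum>j\<in>m. 2 * (c j * ip (\<phi> j) S) + 2 / sqrt (real n) * (c j * zeta M \<xi> \<phi> n j \<omega>))"
    by (intro sum.cong refl) (simp only: I distrib_left mult.left_commute)
  also have "\<dots> = 2 * (\<Sum>j\<in>m. c j * ip (\<phi> j) S) + 2 / sqrt (real n) * (\<Sum>j\<in>m. c j * zeta M \<xi> \<phi> n j \<omega>)"
    by (simp only: sum.distrib sum_distrib_left)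
  also have "(\<Sum>j\<in>m. c j * ip (\<phi> j) S) = ip x S"
    unfolding x by (rule ip_sum_left[symmetric]) (simp_all add: \<phi>1 S1)
  finally show ?thesis by (simp add: contrast_def normsq_diff[OF x1 S1])
qed

text \<open>The inequality holds for arbitrary numbers \<open>z j\<close>, so the coefficients of
  the estimators may depend on the noise in any way.\<close>

lemma noise_increment_le:
  fixes z :: "nat \<Rightarrow> real"
  assumes \<phi>: "orthonormal_system \<phi>" and S: "S \<in> L2_on 1" and n: "n \<ge> 1"
    and m: "finite m" "m \<subseteq> {1..}" and k: "finite k" "k \<subseteq> {1..}"
    and x: "x = (\<lambda>t. \<Sum>j\<in>m. c j * \<phi> j t)" and x': "x' = (\<lambda>t. \<Sum>j\<in>k. c' j * \<phi> j t)"
  shows "2 / sqrt (real n) * ((\<Sum>j\<in>k. c' j * z j) - (\<Sum>j\<in>m. c j * z j))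
    \<le> normsq (\<lambda>t. x' t - S t) / 2 + normsq (\<lambda>t. x t - S t) / 2 + 4 / real n * (\<Sum>j\<in>m \<union> k. (z j)\<^sup>2)"
proof -
  have mk: "finite (m \<union> k)" "m \<union> k \<subseteq> {1..}" using m k by auto
  \<comment> \<open>These are the coefficients of \<open>x' - x\<close> on the union of both
    models.\<close>
  define d where "d j = (if j \<in> k then c' j else 0) - (if j \<in> m then c j else 0)" for j
  have diff: "(\<Sum>j\<in>k. c' j * f j) - (\<Sum>j\<in>m. c j * f j) = (\<Sum>j\<in>m \<union> k. d j * f j)" for f :: "nat \<Rightarrow> real"
  proof -
    have "(\<Sum>j\<in>k. c' j * f j) = (\<Sum>j\<in>m \<union> k. (if j \<in> k then c' j else 0) * f j)"
      using mk by (intro sum.mono_neutral_cong_left) auto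
    moreover have "(\<Sum>j\<in>m. c j * f j) = (\<Sum>j\<in>m \<union> k. (if j \<in> m then c j else 0) * f j)"
      using mk by (intro sum.mono_neutral_cong_left) auto
    ultimately show ?thesis by (simp only: d_def left_diff_distrib sum_subtractf)
  qed
  have "(\<Sum>j\<in>m \<union> k. (d j)\<^sup>2) = normsq (\<lambda>t. x' t - x t)"
    unfolding x x' diff by (rule normsq_orthonormal_sum[OF \<phi> mk, symmetric])
  also have "\<dots> \<le> 2 * normsq (\<lambda>t. x' t - S t) + 2 * normsq (\<lambda>t. x t - S t)"
    unfolding x x' using m k S
    by (intro normsq_diff_le L2_on_sum orthonormal_system_L2[OF \<phi>]) auto
  finally have d2: "(\<Sum>j\<in>m \<union> k. (d j)\<^sup>2) \<le> 2 * normsq (\<lambda>t. x' t - S t) + 2 * normsq (\<lambda>t. x t - S t)" .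
  \<comment> \<open>The weight 1/4 is chosen so that, by \<open>d2\<close>, the squares of
    \<open>d\<close> cost only half of each loss; half of the selected loss then survives on the
    left in the final comparison.\<close>
  have "2 / sqrt (real n) * (d j * z j) \<le> (d j)\<^sup>2 / 4 + 4 / real n * (z j)\<^sup>2" for j
  proof -
    have "0 \<le> (d j / 2 - 2 / sqrt (real n) * z j)\<^sup>2" by simp
    also have "\<dots> = (d j)\<^sup>2 / 4 - 2 / sqrt (real n) * (d j * z j) + 4 / real n * (z j)\<^sup>2"
      using n by (simp add: power2_diff power_divide power_mult_distrib)
    finally show ?thesis by simp
  qed
  hence "2 / sqrt (real n) * (\<Sum>j\<in>m \<union> k. d j * z j) \<le> (\<Sum>j\<in>m \<union> k. (d j)\<^sup>2 / 4 + 4 / real n * (z j)\<^sup>2)"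
    unfolding sum_distrib_left by (intro sum_mono)
  also have "\<dots> = (\<Sum>j\<in>m \<union> k. (d j)\<^sup>2) / 4 + 4 / real n * (\<Sum>j\<in>m \<union> k. (z j)\<^sup>2)"
    by (simp only: sum.distrib sum_distrib_left sum_divide_distrib)
  finally show ?thesis using d2 by (simp only: diff)
qed

section \<open>The remainder terms\<close>

text \<open>\<open>mgf_arg lam\<close> is the \<open>a\<close> with \<open>1 - 2 * a * lam = 1 / z_star\<close>. With \<open>threshold lam l m k\<close> subtracted from the
  square sum, what is left of the two penalties is exactly the term
  \<open>16 * lam * z_star * (card m * l m / n)\<close> of the oracle bound.\<close>

definition mgf_arg :: "real \<Rightarrow> real" where
  "mgf_arg lam = (z_star - 1) / (2 * z_star * lam)"

definition threshold :: "real \<Rightarrow> (nat set \<Rightarrow> real) \<Rightarrow> nat set \<Rightarrow> nat set \<Rightarrow> real" where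
  "threshold lam l m k = lam * (z_star\<^sup>2 / (z_star - 1) * (l k * real (card k)) +
     z_star * (z_star - 2) / (z_star - 1) * (l m * real (card m)))"

text \<open>This is a majorant of \<open>8 / n * (U - threshold)\<close> obtained from
  \<open>t \<le> exp (a * t) / a\<close>. Being nonnegative, it can be summed over all models in
  place of the random one.\<close>

definition remainder :: "real \<Rightarrow> (nat set \<Rightarrow> real) \<Rightarrow> nat \<Rightarrow> nat set \<Rightarrow> nat set \<Rightarrow> real \<Rightarrow> real" where
  "remainder lam l n m k U = 8 / (real n * mgf_arg lam) * exp (mgf_arg lam * (U - threshold lam l m k))"

text \<open>The intermediate value theorem gives a root in [2,4]. No root u lies above a root z in
  this range: the difference u - z would equal ln (u / z), which is at most (u - z) / z. Hence the
  greatest root exists and is this one.\<close>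

lemma z_star_props: "2 \<le> z_star" "ln z_star = z_star - 2"
proof -
  have "\<exists>z\<ge>2. z \<le> 4 \<and> ln z - z + 2 = (0::real)"
  proof (rule IVT2)
    show "ln 4 - 4 + 2 \<le> (0::real)"
      using ln_realpow[of 2 2] ln_2_less_1 by simp
    show "0 \<le> ln 2 - 2 + (2::real)" by simp
  qed (auto intro!: continuous_intros)
  then obtain z where z: "2 \<le> z" "ln z = z - (2::real)" by auto
  have "z_star = z" unfolding z_star_def
  proof (rule Greatest_equality)
    fix u :: real assume u: "0 < u \<and> ln u = u - 2"
    show "u \<le> z"
    proof (rule ccontr)
      assume "\<not> u \<le> z"
      hence uz: "u > z" by simp
      have "u - z = ln (u / z)" using z u by (simp add: ln_div)
      also have "\<dots> \<le> u / z - 1" using z u by (intro ln_le_minus_one) auto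
      also have "\<dots> = (u - z) / z" using z by (simp add: field_simps)
      also have "\<dots> < (u - z) / 1" using z uz by (intro divide_strict_left_mono) auto
      finally show False by simp
    qed
  qed (use z in auto)
  with z show "2 \<le> z_star" "ln z_star = z_star - 2" by auto
qed

lemma mgf_arg_pos: "lam > 0 \<Longrightarrow> mgf_arg lam > 0"
  using z_star_props(1) by (simp add: mgf_arg_def)

lemma remainder_nonneg: "lam > 0 \<Longrightarrow> remainder lam l n m k U \<ge> 0"
  using mgf_arg_pos[of lam] by (simp add: remainder_def)

lemma square_sum_le_remainder:
  assumes lam: "lam > 0" and n: "n \<ge> 1"
  shows "2 * penalty lam l n m - 2 * penalty lam l n k + 8 / real n * U
    \<le> 16 * lam * z_star * (real (card m) * l m / real n) + remainder lam l n m k U"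
proof -
  let ?a = "mgf_arg lam" and ?c = "threshold lam l m k" and ?z = z_star
  have a: "?a > 0" by (rule mgf_arg_pos[OF lam])
  have "1 + ?a * (U - ?c) \<le> exp (?a * (U - ?c))" by (rule exp_ge_add_one_self)
  hence "?a * (U - ?c) \<le> exp (?a * (U - ?c))" by linarith
  hence "U - ?c \<le> exp (?a * (U - ?c)) / ?a" using a by (simp add: le_divide_eq mult.commute)
  hence "8 / real n * (U - ?c) \<le> 8 / real n * (exp (?a * (U - ?c)) / ?a)"
    by (intro mult_left_mono) auto
  hence "8 / real n * U \<le> 8 / real n * ?c + remainder lam l n m k U"
    by (simp add: remainder_def right_diff_distrib)
  moreover have "2 * penalty lam l n m - 2 * penalty lam l n k + 8 / real n * ?c =
      16 * lam * z_star * (real (card m) * l m / real n)"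
  proof -
    \<comment> \<open>The terms in \<open>A\<close>, from the selected model, cancel; those in
      \<open>B\<close> combine through z^2 + z (z - 2) = 2 z (z - 1).\<close>
    have "2 * (4 * lam * (z\<^sup>2 / (z - 1)) * B) - 2 * (4 * lam * (z\<^sup>2 / (z - 1)) * A)
        + 8 * (lam * (z\<^sup>2 / (z - 1) * A + z * (z - 2) / (z - 1) * B)) = 16 * lam * z * B"
      if "z \<ge> 2" for z A B :: real
      using that by (simp add: divide_simps) (simp add: algebra_simps power2_eq_square)
    from this[OF z_star_props(1), of "l m * real (card m) / real n" "l k * real (card k) / real n"]
    show ?thesis by (simp add: penalty_def threshold_def distrib_left add_divide_distrib mult.commute mult.left_commute)
  qed
  ultimately show ?thesis by linarith
qed

text \<open>The exponential moment grows like \<open>exp ((z_star - 2) / 2)\<close> to the power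
  \<open>card m + card k\<close>. The threshold outweighs this because the weights are at least 1,
  and a decaying factor in the selected model is left over.\<close>

lemma (in prob_space) remainder_expectation_le:
  assumes noise: "gaussian_noise M \<xi>" and \<phi>: "orthonormal_system \<phi>" and n: "n \<ge> 1"
    and gauss: "\<And>k. k \<ge> 1 \<Longrightarrow> gaussian_family M {1..k} (zeta M \<xi> \<phi> n)"
    and lmax: "\<And>k. k \<ge> 1 \<Longrightarrow> lambda_max (cov_mat M \<xi> \<phi> k n) \<le> lam"
    and m: "finite m" "m \<subseteq> {1..}" "l m \<ge> 1" and k: "finite k" "k \<subseteq> {1..}" "l k \<ge> 1"
    and lam: "lam > 0"
  shows "(\<integral>\<^sup>+\<omega>. ennreal (remainder lam l n m k (\<Sum>j\<in>m \<union> k. (zeta M \<xi> \<phi> n j \<omega>)\<^sup>2)) \<partial>M)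
    \<le> ennreal (16 * lam * z_star / (real n * (z_star - 1)) * exp (- l k * real (card k)))"
proof -
  let ?a = "mgf_arg lam" and ?c = "threshold lam l m k" and ?z = z_star and ?F = "m \<union> k"
  let ?U = "\<lambda>\<omega>. \<Sum>j\<in>?F. (zeta M \<xi> \<phi> n j \<omega>)\<^sup>2"
  define C where "C = 8 / (real n * ?a) * exp (- ?a * ?c)"
  have a: "?a > 0" by (rule mgf_arg_pos[OF lam])
  have z: "?z \<ge> 2" "ln ?z = ?z - 2" using z_star_props by auto
  have F: "finite ?F" "?F \<subseteq> {1..}" using m k by auto
  have C: "C \<ge> 0" using a by (simp add: C_def)
  have Z[measurable]: "zeta M \<xi> \<phi> n j \<in> borel_measurable M" if "j \<in> ?F" for j
    using gaussian_familyD[OF gauss[of j], of j] F(2) that by (auto simp: normal_rv_def)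
  have alam: "2 * (?a * lam) = 1 - 1 / ?z"
    using lam z by (simp add: mgf_arg_def field_simps)
  have "(\<integral>\<^sup>+\<omega>. ennreal (exp (?a * ?U \<omega>)) \<partial>M) \<le> ennreal ((1 / sqrt (1 - 2 * (?a * lam))) ^ card ?F)"
    by (rule nn_integral_exp_sum_squares_le[OF F(1) Z zeta_mgf_le[OF noise \<phi> n gauss lmax F]])
      (use a z in \<open>auto simp: alam\<close>)
  also have "1 / sqrt (1 - 2 * (?a * lam)) = sqrt ?z"
    unfolding alam using z by (simp add: real_sqrt_divide)
  \<comment> \<open>The overlap of the models is ignored; enlarging the exponent is harmless because
    the base is at least 1.\<close>
  also have "sqrt ?z ^ card ?F \<le> sqrt ?z ^ (card m + card k)"
    using z card_Un_le[of m k] by (intro power_increasing) auto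
  also have "\<dots> = exp ((?z - 2) / 2 * (real (card m) + real (card k)))"
  proof -
    \<comment> \<open>The defining equation of \<open>z_star\<close> makes the moment bound an
      exponential that is linear in the dimensions, like the threshold.\<close>
    have "sqrt ?z = exp ((?z - 2) / 2)"
      using z by (simp add: ln_sqrt flip: ln_inj_iff)
    thus ?thesis by (simp add: exp_of_nat_mult[symmetric] mult.commute)
  qed
  finally have mgf: "(\<integral>\<^sup>+\<omega>. ennreal (exp (?a * ?U \<omega>)) \<partial>M)
      \<le> ennreal (exp ((?z - 2) / 2 * (real (card m) + real (card k))))"
    by (simp add: ennreal_leI)
  have "(\<integral>\<^sup>+\<omega>. ennreal (remainder lam l n m k (?U \<omega>)) \<partial>M) = (\<integral>\<^sup>+\<omega>. ennreal C * ennreal (exp (?a * ?U \<omega>)) \<partial>M)"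
  proof -
    have "remainder lam l n m k u = C * exp (?a * u)" for u
      by (simp add: remainder_def C_def right_diff_distrib exp_diff exp_minus divide_inverse)
    thus ?thesis using C by (simp add: ennreal_mult)
  qed
  also have "\<dots> = ennreal C * (\<integral>\<^sup>+\<omega>. ennreal (exp (?a * ?U \<omega>)) \<partial>M)"
    by (rule nn_integral_cmult) measurable
  also have "\<dots> \<le> ennreal C * ennreal (exp ((?z - 2) / 2 * (real (card m) + real (card k))))"
    by (intro mult_left_mono mgf) simp
  also have "\<dots> = ennreal (8 / (real n * ?a) * exp (- ?a * ?c + (?z - 2) / 2 * (real (card m) + real (card k))))"
    by (simp only: ennreal_mult''[OF exp_ge_zero, symmetric] C_def exp_add mult.assoc)
  also have "\<dots> \<le> ennreal (8 / (real n * ?a) * exp (- l k * real (card k)))"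
  proof -
    have ac: "?a * ?c = ?z / 2 * (l k * real (card k)) + (?z - 2) / 2 * (l m * real (card m))"
    proof -
      have "(u - 1) / (2 * u * lam) * (lam * (u\<^sup>2 / (u - 1) * A + u * (u - 2) / (u - 1) * B)) =
          u / 2 * A + (u - 2) / 2 * B" if "u \<ge> 2" for u A B :: real
        using that lam by (simp add: divide_simps) (simp add: algebra_simps power2_eq_square)
      from this[OF z(1)] show ?thesis unfolding mgf_arg_def threshold_def .
    qed
    have le: "(?z - 2) / 2 * real (card p) \<le> (?z - 2) / 2 * (l p * real (card p))" if "l p \<ge> 1" for p
      using z that mult_right_mono[OF that, of "real (card p)"] by (intro mult_left_mono) auto
    \<comment> \<open>Of the coefficient z/2, the part (z - 2)/2 absorbs the growth in
      \<open>card k\<close>, and the remaining 1 gives the summable factor.\<close>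
    have "?z / 2 * (l k * real (card k)) = (?z - 2) / 2 * (l k * real (card k)) + l k * real (card k)"
      by (simp add: diff_divide_distrib left_diff_distrib)
    hence "- ?a * ?c + (?z - 2) / 2 * (real (card m) + real (card k)) \<le> - l k * real (card k)"
      using le[OF m(3)] le[OF k(3)] ac unfolding distrib_left mult_minus_left by linarith
    thus ?thesis using a by (intro ennreal_leI mult_left_mono) auto
  qed
  also have "8 / (real n * ?a) = 16 * lam * ?z / (real n * (?z - 1))"
    using lam z by (simp add: mgf_arg_def)
  finally show ?thesis .
qed

section \<open>The oracle inequality\<close>

text \<open>This supplies explicit coefficients for an estimator, namely the scalar products that
  occur in \<open>contrast\<close> and whose measurability is assumed.\<close>

lemma D_space_eq_sum_ip:
  assumes \<phi>: "orthonormal_system \<phi>" and m: "finite m" "m \<subseteq> {1..}" and x: "x \<in> D_space \<phi> m"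
  shows "x = (\<lambda>t. \<Sum>j\<in>m. ip x (\<phi> j) * \<phi> j t)"
proof -
  from x obtain c where c: "x = (\<lambda>t. \<Sum>j\<in>m. c j * \<phi> j t)" by (auto simp: D_space_def)
  have "ip x (\<phi> j) = c j" if "j \<in> m" for j
    unfolding c using ip_orthonormal_sum[OF \<phi> m, of j c] m that by auto
  hence "(\<lambda>t. \<Sum>j\<in>m. ip x (\<phi> j) * \<phi> j t) = (\<lambda>t. \<Sum>j\<in>m. c j * \<phi> j t)" by simp
  with c show ?thesis by simp
qed

lemma selected_loss_le:
  assumes \<phi>: "orthonormal_system \<phi>" and S: "S \<in> L2_per" and n: "n \<ge> 1" and lam: "lam > 0"
    and m: "finite m" "m \<subseteq> {1..}" and k: "finite k" "k \<subseteq> {1..}"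
    and x: "x \<in> D_space \<phi> m" and x': "x' \<in> D_space \<phi> k"
    and le: "contrast M S \<xi> \<phi> n k x' \<omega> + penalty lam l n k
      \<le> contrast M S \<xi> \<phi> n m x \<omega> + penalty lam l n m"
  shows "normsq (\<lambda>t. x' t - S t) \<le> 3 * normsq (\<lambda>t. x t - S t)
    + 16 * lam * z_star * (real (card m) * l m / real n)
    + remainder lam l n m k (\<Sum>j\<in>m \<union> k. (zeta M \<xi> \<phi> n j \<omega>)\<^sup>2)"
proof -
  let ?U = "\<Sum>j\<in>m \<union> k. (zeta M \<xi> \<phi> n j \<omega>)\<^sup>2"
  have S1: "S \<in> L2_on 1" using S by (simp add: L2_per_def)
  note xm = D_space_eq_sum_ip[OF \<phi> m x] and xk = D_space_eq_sum_ip[OF \<phi> k x']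
  \<comment> \<open>The factor 3/2 is 1 from the contrast comparison plus 1/2 from the noise
    increment; doubling gives the 3 of the oracle bound.\<close>
  have "normsq (\<lambda>t. x' t - S t) / 2 \<le> 3 / 2 * normsq (\<lambda>t. x t - S t)
      + penalty lam l n m - penalty lam l n k + 4 / real n * ?U"
    using le noise_increment_le[OF \<phi> S1 n m k xm xk, of "\<lambda>j. zeta M \<xi> \<phi> n j \<omega>"]
    unfolding contrast_eq[OF \<phi> S n m xm] contrast_eq[OF \<phi> S n k xk] right_diff_distrib
    by linarith
  hence "normsq (\<lambda>t. x' t - S t) \<le> 3 * normsq (\<lambda>t. x t - S t)
      + (2 * penalty lam l n m - 2 * penalty lam l n k + 8 / real n * ?U)"
    by simp
  with square_sum_le_remainder[OF lam n, of l m k ?U] show ?thesis by linarith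
qed

lemma measurable_ip_estimate:
  assumes noise: "gaussian_noise M \<xi>" and y: "observed_process M S \<xi> y"
    and est: "projective_estimators \<phi> n \<M> est" and m: "m \<in> \<M>" and x: "x \<in> L2_per"
  shows "(\<lambda>\<omega>. ip (estimate n y (est m) \<omega>) x) \<in> borel_measurable M"
proof -
  have \<xi>[measurable]: "\<xi> t \<in> borel_measurable M" if "t \<ge> 0" for t
    using noise that unfolding gaussian_noise_def gaussian_family_def normal_rv_def
    by (auto dest!: spec[of _ "{t}"] spec[of _ "\<lambda>_. 1"])
  have y0[measurable]: "y 0 \<in> borel_measurable M" using y by (simp add: observed_process_def)
  have "y t \<in> borel_measurable M" if "t \<ge> 0" for t
  proof -
    have "(\<lambda>\<omega>. y 0 \<omega> + (LINT s:{0..t}|lebesgue. S s) + (\<xi> t \<omega> - \<xi> 0 \<omega>)) \<in> borel_measurable M"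
      using \<xi>[OF that] \<xi>[of 0] by (intro borel_measurable_add borel_measurable_diff y0) auto
    moreover have "y t \<omega> = y 0 \<omega> + (LINT s:{0..t}|lebesgue. S s) + (\<xi> t \<omega> - \<xi> 0 \<omega>)"
      if "\<omega> \<in> space M" for \<omega>
      using y \<open>t \<ge> 0\<close> that unfolding observed_process_def by blast
    ultimately show ?thesis by (rule measurable_cong[THEN iffD2, rotated])
  qed
  hence "(\<lambda>\<omega>. \<lambda>t\<in>{0..real n}. y t \<omega>) \<in> measurable M (Pi\<^sub>M {0..real n} (\<lambda>_. borel))"
    by (intro measurable_restrict) auto
  moreover have "(\<lambda>p. ip (est m p) x) \<in> borel_measurable (Pi\<^sub>M {0..real n} (\<lambda>_. borel))"
    using est m x by (simp add: projective_estimators_def)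
  ultimately show ?thesis
    unfolding estimate_def by (rule measurable_compose)
qed

text \<open>Estimators are measurable only through scalar products, so the loss is expanded into
  finitely many of them: those with the \<open>\<phi> j\<close> and the one with
  \<open>S\<close>.\<close>

lemma measurable_normsq_estimate:
  assumes noise: "gaussian_noise M \<xi>" and S: "S \<in> L2_per" and y: "observed_process M S \<xi> y"
    and \<phi>: "orthonormal_system \<phi>" and est: "projective_estimators \<phi> n \<M> est" and m: "m \<in> \<M>"
    and fin: "finite m" "m \<subseteq> {1..}"
    and D: "\<And>\<omega>. estimate n y (est m) \<omega> \<in> D_space \<phi> m"
  shows "(\<lambda>\<omega>. normsq (\<lambda>t. estimate n y (est m) \<omega> t - S t)) \<in> borel_measurable M"
proof -
  let ?x = "\<lambda>\<omega>. estimate n y (est m) \<omega>"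
  have S1: "S \<in> L2_on 1" using S by (simp add: L2_per_def)
  have "normsq (\<lambda>t. ?x \<omega> t - S t) = (\<Sum>j\<in>m. (ip (?x \<omega>) (\<phi> j))\<^sup>2) - 2 * ip (?x \<omega>) S + normsq S" for \<omega>
  proof -
    note x = D_space_eq_sum_ip[OF \<phi> fin D[of \<omega>]]
    have "?x \<omega> \<in> L2_on 1"
      by (subst x) (use fin in \<open>auto intro!: L2_on_sum orthonormal_system_L2[OF \<phi>]\<close>)
    moreover have "normsq (?x \<omega>) = (\<Sum>j\<in>m. (ip (?x \<omega>) (\<phi> j))\<^sup>2)"
      by (subst x) (rule normsq_orthonormal_sum[OF \<phi> fin])
    ultimately show ?thesis by (simp add: normsq_diff S1)
  qed
  moreover have "\<phi> j \<in> L2_per" if "j \<in> m" for j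
    using \<phi> fin that by (auto simp: orthonormal_system_def)
  ultimately show ?thesis
    using S by (auto intro!: borel_measurable_add borel_measurable_diff borel_measurable_sum
        borel_measurable_power borel_measurable_times measurable_ip_estimate[OF noise y est m])
qed

theorem theorem1:
  fixes M :: "'w measure" and \<xi> y :: "real \<Rightarrow> 'w \<Rightarrow> real" and S :: "real \<Rightarrow> real"
    and \<phi> :: "nat \<Rightarrow> real \<Rightarrow> real" and n :: nat
    and \<M> :: "nat set set" and l :: "nat set \<Rightarrow> real" and lam :: real
    and est :: "nat set \<Rightarrow> (real \<Rightarrow> real) \<Rightarrow> (real \<Rightarrow> real)" and \<kappa> :: "'w \<Rightarrow> nat set"
  assumes "prob_space M"
    and "gaussian_noise M \<xi>"
    and "S \<in> L2_per"
    and "observed_process M S \<xi> y"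
    and "orthonormal_system \<phi>"
    and "n \<ge> 1"
    and "finite \<M>" and "\<M> \<noteq> {}" and "\<And>m. m \<in> \<M> \<Longrightarrow> finite m \<and> m \<subseteq> {1..}"
    and "\<And>m. m \<in> \<M> \<Longrightarrow> l m \<ge> 1"
    and "lam > 0"
    and cond_i: "\<And>N k :: nat. N \<ge> 1 \<Longrightarrow> k \<ge> 1 \<Longrightarrow>
        gaussian_family M {1..k} (zeta M \<xi> \<phi> N) \<and> invertible_mat (cov_mat M \<xi> \<phi> k N)"
    and cond_ii: "(SUP k\<in>{1::nat..}. SUP N\<in>{1::nat..}. ereal (lambda_max (cov_mat M \<xi> \<phi> k N)))
        \<le> ereal lam"
    and "projective_estimators \<phi> n \<M> est"
    and "selects_model M S \<xi> y \<phi> n \<M> lam l est \<kappa>"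
  shows "risk M S (\<lambda>\<omega>. estimate n y (est (\<kappa> \<omega>)) \<omega>)
      \<le> (INF m\<in>\<M>. a_tilde M S y n lam l est m) + ennreal (lam * tau_0 \<M> l / real n)"
proof -
  interpret prob_space M by fact
  note noise = assms(2) and S = assms(3) and y = assms(4) and \<phi> = assms(5) and n = assms(6)
    and models = assms(7,8,9) and l1 = assms(10) and lam = assms(11)
    and est = assms(14) and sel = assms(15)
  have gauss: "gaussian_family M {1..k} (zeta M \<xi> \<phi> n)" if "k \<ge> 1" for k
    using cond_i[OF n that] by blast
  have lmax: "lambda_max (cov_mat M \<xi> \<phi> k n) \<le> lam" if k: "k \<ge> 1" for k
  proof -
    have "ereal (lambda_max (cov_mat M \<xi> \<phi> k n)) \<le> (SUP N\<in>{1::nat..}. ereal (lambda_max (cov_mat M \<xi> \<phi> k N)))"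
      using n by (intro SUP_upper) auto
    also have "\<dots> \<le> (SUP k\<in>{1::nat..}. SUP N\<in>{1::nat..}. ereal (lambda_max (cov_mat M \<xi> \<phi> k N)))"
      using k by (intro SUP_upper[of k "{1..}" "\<lambda>k. SUP N\<in>{1..}. ereal (lambda_max (cov_mat M \<xi> \<phi> k N))"]) auto
    also note cond_ii
    finally show ?thesis by simp
  qed
  let ?x = "\<lambda>m \<omega>. estimate n y (est m) \<omega>"
  let ?L = "\<lambda>m \<omega>. normsq (\<lambda>t. ?x m \<omega> t - S t)"
  let ?W = "\<lambda>m k \<omega>. remainder lam l n m k (\<Sum>j\<in>m \<union> k. (zeta M \<xi> \<phi> n j \<omega>)\<^sup>2)"
  \<comment> \<open>A restricted path always belongs to the space of the product measure, so this
    holds for every \<omega>, with no exceptional set.\<close>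
  have D: "?x m \<omega> \<in> D_space \<phi> m" if "m \<in> \<M>" for m \<omega>
    using est that unfolding projective_estimators_def estimate_def by (auto simp: space_PiM)
  have L[measurable]: "?L m \<in> borel_measurable M" if "m \<in> \<M>" for m
    using models(3)[OF that] by (intro measurable_normsq_estimate[OF noise S y \<phi> est that] D that) auto
  have Z: "zeta M \<xi> \<phi> n j \<in> borel_measurable M" if "j \<ge> 1" for j
    using gaussian_familyD[OF gauss[of j], of j] that by (auto simp: normal_rv_def)
  have W[measurable]: "?W m k \<in> borel_measurable M" if "m \<in> \<M>" "k \<in> \<M>" for m k
    unfolding remainder_def using models(3)[OF that(1)] models(3)[OF that(2)]
    by (intro borel_measurable_times borel_measurable_const borel_measurable_exp[THEN measurable_compose_rev]
        borel_measurable_diff borel_measurable_sum borel_measurable_power Z) auto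
  have sumW: "(\<Sum>k\<in>\<M>. \<integral>\<^sup>+\<omega>. ennreal (?W m k \<omega>) \<partial>M) \<le> ennreal (lam * tau_0 \<M> l / real n)" if m: "m \<in> \<M>" for m
  proof -
    let ?C = "16 * lam * z_star / (real n * (z_star - 1))"
    have "(\<Sum>k\<in>\<M>. \<integral>\<^sup>+\<omega>. ennreal (?W m k \<omega>) \<partial>M) \<le> (\<Sum>k\<in>\<M>. ennreal (?C * exp (- l k * real (card k))))"
      using models(3) l1 m
      by (intro sum_mono remainder_expectation_le[OF noise \<phi> n gauss lmax _ _ _ _ _ _ lam]) auto
    also have "\<dots> = ennreal (\<Sum>k\<in>\<M>. ?C * exp (- l k * real (card k)))"
      using lam z_star_props(1) by (intro sum_ennreal) auto
    also have "(\<Sum>k\<in>\<M>. ?C * exp (- l k * real (card k))) = lam * tau_0 \<M> l / real n"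
      unfolding tau_0_def l_star_def sum_distrib_left[symmetric] by (simp add: mult.commute mult.left_commute)
    finally show ?thesis .
  qed
  have bound: "risk M S (\<lambda>\<omega>. ?x (\<kappa> \<omega>) \<omega>) \<le> a_tilde M S y n lam l est m + ennreal (lam * tau_0 \<M> l / real n)"
    if m: "m \<in> \<M>" for m
  proof -
    let ?c = "16 * lam * z_star * (real (card m) * l m / real n)"
    have c: "?c \<ge> 0" using lam z_star_props(1) l1[OF m] by simp
    \<comment> \<open>The term of the random model is bounded by the sum over all models, which
      makes the right side independent of \<open>\<kappa>\<close> and lets each expectation be taken
      for a fixed model.\<close>
    have "AE \<omega> in M. ennreal (?L (\<kappa> \<omega>) \<omega>) \<le> 3 * ennreal (?L m \<omega>) + ennreal ?c + (\<Sum>k\<in>\<M>. ennreal (?W m k \<omega>))"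
      using sel[unfolded selects_model_def, THEN conjunct2]
    proof eventually_elim
      case (elim \<omega>)
      hence k: "\<kappa> \<omega> \<in> \<M>"
        and le: "contrast M S \<xi> \<phi> n (\<kappa> \<omega>) (?x (\<kappa> \<omega>) \<omega>) \<omega> + penalty lam l n (\<kappa> \<omega>)
          \<le> contrast M S \<xi> \<phi> n m (?x m \<omega>) \<omega> + penalty lam l n m"
        using m by (auto simp: is_arg_min_linorder)
      have "?L (\<kappa> \<omega>) \<omega> \<le> 3 * ?L m \<omega> + ?c + ?W m (\<kappa> \<omega>) \<omega>"
        using models(3)[OF m] models(3)[OF k]
        by (intro selected_loss_le[OF \<phi> S n lam _ _ _ _ D[OF m] D[OF k] le]) auto
      hence "ennreal (?L (\<kappa> \<omega>) \<omega>) \<le> ennreal (3 * ?L m \<omega> + ?c + ?W m (\<kappa> \<omega>) \<omega>)"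
        by (rule ennreal_leI)
      also have "\<dots> = 3 * ennreal (?L m \<omega>) + ennreal ?c + ennreal (?W m (\<kappa> \<omega>) \<omega>)"
        using c remainder_nonneg[OF lam] by (simp add: ennreal_plus normsq_nonneg ennreal_mult)
      also have "ennreal (?W m (\<kappa> \<omega>) \<omega>) \<le> (\<Sum>k\<in>\<M>. ennreal (?W m k \<omega>))"
        using k models(1) by (intro member_le_sum) auto
      finally show ?case by (simp add: add_left_mono)
    qed
    hence "risk M S (\<lambda>\<omega>. ?x (\<kappa> \<omega>) \<omega>) \<le>
        (\<integral>\<^sup>+\<omega>. 3 * ennreal (?L m \<omega>) + ennreal ?c + (\<Sum>k\<in>\<M>. ennreal (?W m k \<omega>)) \<partial>M)"
      unfolding risk_def by (rule nn_integral_mono_AE)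
    also have "\<dots> = 3 * (\<integral>\<^sup>+\<omega>. ennreal (?L m \<omega>) \<partial>M) + ennreal ?c + (\<Sum>k\<in>\<M>. \<integral>\<^sup>+\<omega>. ennreal (?W m k \<omega>) \<partial>M)"
      using L[OF m] W[OF m] by (simp add: nn_integral_add nn_integral_sum nn_integral_cmult emeasure_space_1)
    also have "\<dots> \<le> a_tilde M S y n lam l est m + ennreal (lam * tau_0 \<M> l / real n)"
      unfolding a_tilde_def risk_def by (intro add_left_mono sumW m)
    finally show ?thesis .
  qed
  \<comment> \<open>The infimum over a finite nonempty set is attained, so the bound for a single
    model suffices.\<close>
  have "(INF m\<in>\<M>. a_tilde M S y n lam l est m) \<in> (\<lambda>m. a_tilde M S y n lam l est m) ` \<M>"
    using models(1,2) Min_in[of "(\<lambda>m. a_tilde M S y n lam l est m) ` \<M>"] by (simp add: Min_Inf)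
  then obtain m where "m \<in> \<M>" "(INF m\<in>\<M>. a_tilde M S y n lam l est m) = a_tilde M S y n lam l est m"
    by auto
  with bound[of m] show ?thesis by simp
qed

end
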